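(* Let $C$ be a convex cone in $\mathbb{R}^d$, and let $$w(C):=\mathbb{E}\Big[\sup_{y\in C\cap\mathsf{S}^{d-1}}\langle y,g\rangle\Big]$$ be its Gaussian width, where $g$ is a standard normal vector in $\mathbb{R}^d$ and $\mathsf{S}^{d-1}$ is the Euclidean unit sphere. Then $$w^2(C)\le\delta(C)\le w^2(C)+1,$$ where $\delta(C)$ is the statistical dimension of $C$.
   Context: A convex cone in $\mathbb{R}^d$ is a convex set $C$ with $C=\tau C$ for all $\tau>0$. For a closed convex cone $C$, $\Pi_C(x)$ denotes the point of $C$ nearest to $x$ in Euclidean norm. Conic intrinsic volumes: a cone is polyhedral if it is an intersection of finitely many halfspaces. For a polyhedral cone $C\subset\mathbb{R}^d$ and $k=0,\dots,d$, $v_k(C) := \mathbb{P}\{\Pi_C(g)$ lies in the relative interior of a $k$-dimensional face of $C\}$. For a general closed convex cone $C$, $v_k(C):=\lim_{i\to\infty} v_k(C_i)$, where $(C_i)$ is any sequence of polyhedral cones converging to $C$ in the conic Hausdorff metric (identify each closed convex cone with its intersection with the unit sphere $\mathsf{S}^{d-1}$ and use the Hausdorff metric on the sphere); the limit does not depend on the sequence. Statistical dimension: for a closed convex cone $C\subset \mathbb{R}^d$, $\delta(C):=\sum_{k=0}^d k\,v_k(C)$. The statistical dimension of a general convex cone is that of its closure. *)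

theory Defs
  imports "HOL-Probability.Probability"
begin

text \<open>The law of a standard normal vector: independent standard normal coordinates.\<close>

definition std_gaussian :: "'a::euclidean_space measure" where
  "std_gaussian = density lborel (\<lambda>x. ennreal (\<Prod>b\<in>Basis. std_normal_density (x \<bullet> b)))"

text \<open>The library's \<^const>\<open>convex_cone\<close> is nonempty and invariant under scaling by all
  \<open>c \<ge> 0\<close>, so it contains the origin. A nonempty closed set invariant under scaling by all
  \<open>c > 0\<close> contains the origin too; for nonempty closed sets the two notions of cone agree.\<close>

definition polyhedral_cone :: "'a::euclidean_space set \<Rightarrow> bool" where
  "polyhedral_cone C \<longleftrightarrow> convex_cone C \<and> polyhedron C"

definition polyhedral_intrinsic_volume :: "nat \<Rightarrow> 'a::euclidean_space set \<Rightarrow> real" where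
  "polyhedral_intrinsic_volume k C =
     measure std_gaussian
       {g. \<exists>F. F face_of C \<and> aff_dim F = int k \<and> closest_point C g \<in> rel_interior F}"

text \<open>The two clauses for the empty set are needed because the trivial cone \<open>{0}\<close> does not meet
  the sphere. It is at distance 1 from every other cone, hence isolated.\<close>

definition hausdorff_dist :: "'a::metric_space set \<Rightarrow> 'a set \<Rightarrow> real" where
  "hausdorff_dist A B =
     (if A = {} \<and> B = {} then 0
      else if A = {} \<or> B = {} then 1
      else max (SUP x\<in>A. infdist x B) (SUP y\<in>B. infdist y A))"

text \<open>The sphere carries the Euclidean (chordal) distance, which is uniformly equivalent to the
  geodesic distance and therefore yields the same convergent sequences of cones.\<close>

definition conic_hausdorff_dist :: "'a::euclidean_space set \<Rightarrow> 'a set \<Rightarrow> real" where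
  "conic_hausdorff_dist C D = hausdorff_dist (C \<inter> sphere 0 1) (D \<inter> sphere 0 1)"

definition intrinsic_volume :: "nat \<Rightarrow> 'a::euclidean_space set \<Rightarrow> real" where
  "intrinsic_volume k C =
     (THE v. \<forall>P :: nat \<Rightarrow> 'a set.
        (\<forall>i. polyhedral_cone (P i)) \<and> (\<lambda>i. conic_hausdorff_dist (P i) C) \<longlonglongrightarrow> 0
        \<longrightarrow> (\<lambda>i. polyhedral_intrinsic_volume k (P i)) \<longlonglongrightarrow> v)"

definition statistical_dimension :: "'a::euclidean_space set \<Rightarrow> real" where
  "statistical_dimension C = (\<Sum>k=0..DIM('a). real k * intrinsic_volume k (closure C))"

text \<open>The supremum over the empty set (the trivial cone \<open>{0}\<close>) is 0 by convention; \<^const>\<open>Sup\<close> on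
  the reals is unspecified there.\<close>

definition gaussian_width :: "'a::euclidean_space set \<Rightarrow> real" where
  "gaussian_width C =
     (\<integral>g. (if C \<inter> sphere 0 1 = {} then 0 else SUP y\<in>C \<inter> sphere 0 1. y \<bullet> g) \<partial>std_gaussian)"

end

theory Submission
  imports Defs "HOL-Computational_Algebra.Polynomial"
begin

text \<open>Let \<open>h(g)\<close> be the supremum of \<open>\<langle>y,g\<rangle>\<close> over the unit vectors of the cone; then the metric
  projection of \<open>g\<close> onto the closed cone has norm \<open>N(g) = max 0 (h(g))\<close>.

  If a polyhedral cone projects \<open>g\<close> into the relative interior of a face \<open>F\<close>, it does so for every
  point obtained from \<open>g\<close> by rescaling along the span of \<open>F\<close>. Rescaling by \<open>t\<close> in the Gaussian integral
  over the region of \<open>F\<close> therefore yields \<open>E exp(-(t\<^sup>2-1)N\<^sup>2/2) = \<Sum>k. v\<^sub>k (1/t)^k\<close>. The left-hand side depends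
  continuously on the cone because \<open>h\<close> does. Finitely many values of \<open>t\<close> determine the coefficients by
  Lagrange interpolation, so the intrinsic volumes converge along polyhedral approximations, and the
  identity extends to all closed convex cones. Differentiating at \<open>t = 1\<close> gives \<open>\<delta> = E N\<^sup>2\<close>.

  Since \<open>0 \<le> w = E h \<le> E N\<close>, Jensen's inequality gives \<open>w\<^sup>2 \<le> \<delta>\<close>. Conversely \<open>\<delta> \<le> E h\<^sup>2 = w\<^sup>2 + Var h\<close>,
  and \<open>Var h \<le> 1\<close> by the Gaussian Poincare inequality, \<open>h\<close> being a limit of smooth functions
  (log-sum-exp of finitely many \<open>\<langle>y,g\<rangle>\<close>) whose gradients are averages of unit vectors.\<close>

subsection \<open>Linear images of Gaussian measure\<close>

text \<open>Since \<open>intrinsic_volume\<close> is a \<open>THE\<close>, two facts are needed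
  before it means anything: all approximating polyhedral sequences share one limit, and at least one
  such sequence exists. The faces of the approximants need not resemble those of the limit cone, so
  volumes are never compared face by face; they are recovered from finitely many values of a
  function of \<open>t\<close> that sees the cone only through N. For \<open>t \<ge> 1\<close> the
  exponent is nonpositive and the constant 1 dominates the integrands; this is why limits are taken
  only there and the derivative at 1 is approached from the right.

  The functions h and N differ where h is negative, which happens for g in the interior of the polar
  cone. N carries the statistical dimension, h the width and the variance bound.

  The constant 1 in the Poincare inequality comes from an exact identity: for independent standard
  normal X and Y, the expectation of Y - X restricted to X \<le> u < Y is the normal density at u.
  Combined with Var F = E (F(X) - F(Y))^2 / 2 and Cauchy-Schwarz it settles one dimension; the law
  of total variance settles products.\<close>

definition gauss_density :: "'a::euclidean_space \<Rightarrow> real" where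
  "gauss_density x = (\<Prod>b\<in>Basis. std_normal_density (x \<bullet> b))"

lemma gauss_density_eq:
  "gauss_density (x::'a::euclidean_space) = (1 / sqrt (2 * pi)) ^ DIM('a) * exp (- (norm x)\<^sup>2 / 2)"
proof -
  have "(norm x)\<^sup>2 = (\<Sum>b\<in>Basis. (x \<bullet> b)\<^sup>2)"
    unfolding power2_norm_eq_inner by (subst euclidean_inner) (simp add: power2_eq_square)
  then have "- (norm x)\<^sup>2 / 2 = (\<Sum>b\<in>Basis. - (x \<bullet> b)\<^sup>2 / 2)"
    by (simp add: sum_negf sum_divide_distrib)
  then show ?thesis
    unfolding gauss_density_def std_normal_density_def prod.distrib
    by (simp add: exp_sum)
qed

lemma gauss_density_nonneg [simp]: "0 \<le> gauss_density x"
  by (simp add: gauss_density_def prod_nonneg)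

lemma borel_measurable_gauss_density [measurable]: "gauss_density \<in> borel_measurable borel"
  unfolding gauss_density_eq[abs_def] by measurable

lemma gauss_density_cong_norm:
  fixes x y :: "'a::euclidean_space"
  shows "norm x = norm y \<Longrightarrow> gauss_density x = gauss_density y"
  by (simp add: gauss_density_eq)

lemma std_gaussian_eq: "std_gaussian = density lborel (\<lambda>x. ennreal (gauss_density x))"
  by (simp add: std_gaussian_def gauss_density_def)

lemma sets_std_gaussian [simp, measurable_cong]: "sets std_gaussian = sets borel"
  by (simp add: std_gaussian_def)

lemma space_std_gaussian [simp]: "space std_gaussian = UNIV"
  by (simp add: std_gaussian_def)

lemma nn_integral_std_gaussian:
  assumes [measurable]: "h \<in> borel_measurable borel"
  shows "(\<integral>\<^sup>+x. h x \<partial>std_gaussian) = (\<integral>\<^sup>+x. ennreal (gauss_density x) * h x \<partial>lborel)"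
  unfolding std_gaussian_eq by (subst nn_integral_density) auto

lemma nn_integral_std_normal_density: "(\<integral>\<^sup>+x. ennreal (std_normal_density x) \<partial>lborel) = 1"
  by (subst nn_integral_eq_integral) auto

lemma nn_integral_gauss_density: "(\<integral>\<^sup>+x. ennreal (gauss_density (x::'a::euclidean_space)) \<partial>lborel) = 1"
proof -
  have "(\<integral>\<^sup>+x. ennreal (gauss_density (x::'a)) \<partial>lborel)
      = (\<integral>\<^sup>+x. (\<Prod>b\<in>Basis. ennreal (std_normal_density ((x::'a) \<bullet> b))) \<partial>lborel)"
    by (simp add: gauss_density_def prod_ennreal)
  also have "\<dots> = (\<Prod>b\<in>(Basis::'a set). \<integral>\<^sup>+x. ennreal (std_normal_density x) \<partial>lborel)"
    by (subst nn_integral_lborel_prod) auto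
  finally show ?thesis by (simp add: nn_integral_std_normal_density)
qed

lemma prob_space_std_gaussian: "prob_space (std_gaussian :: 'a::euclidean_space measure)"
proof (rule prob_spaceI)
  have "emeasure (std_gaussian::'a measure) UNIV = (\<integral>\<^sup>+x. 1 \<partial>(std_gaussian::'a measure))"
    by simp
  also have "\<dots> = 1"
    by (subst nn_integral_std_gaussian) (auto simp: nn_integral_gauss_density)
  finally show "emeasure (std_gaussian::'a measure) (space std_gaussian) = 1" by simp
qed

lemma nn_integral_lborel_translate:
  fixes h :: "'a::euclidean_space \<Rightarrow> ennreal"
  assumes [measurable]: "h \<in> borel_measurable borel"
  shows "(\<integral>\<^sup>+x. h (x + z) \<partial>lborel) = (\<integral>\<^sup>+x. h x \<partial>lborel)"
  by (subst (2) lborel_distr_plus[symmetric, of z]) (simp add: nn_integral_distr add.commute)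

text \<open>Averaging translates of \<open>h\<close> against the Gaussian density in two ways shows that a surjective
  linear map changes Lebesgue measure by a constant factor, and gives that factor as a Gaussian
  integral; no determinant is needed.\<close>

lemma nn_integral_lborel_linear:
  fixes f :: "'a::euclidean_space \<Rightarrow> 'a" and h :: "'a \<Rightarrow> ennreal"
  assumes f: "linear f" "surj f" and [measurable]: "h \<in> borel_measurable borel"
  shows "(\<integral>\<^sup>+x. h (f x) \<partial>lborel) = (\<integral>\<^sup>+x. ennreal (gauss_density (f x)) \<partial>lborel) * (\<integral>\<^sup>+x. h x \<partial>lborel)"
proof -
  have [measurable]: "f \<in> borel_measurable borel"
    using f(1) by (intro borel_measurable_continuous_onI linear_continuous_on linear_conv_bounded_linear[THEN iffD1])
  let ?g = "\<lambda>x. ennreal (gauss_density (x::'a))"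
  have "(\<integral>\<^sup>+x. h (f x) \<partial>lborel) = (\<integral>\<^sup>+y. ?g y * (\<integral>\<^sup>+x. h (f x) \<partial>lborel) \<partial>lborel)"
    by (subst nn_integral_multc) (auto simp: nn_integral_gauss_density)
  also have "\<dots> = (\<integral>\<^sup>+y. ?g y * (\<integral>\<^sup>+x. h (f x + y) \<partial>lborel) \<partial>lborel)"
  proof (rule nn_integral_cong)
    fix y :: 'a
    obtain z where z: "f z = y" using f(2) by (metis surjD)
    have "(\<integral>\<^sup>+x. h (f x) \<partial>lborel) = (\<integral>\<^sup>+x. h (f (x + z)) \<partial>lborel)"
      by (subst nn_integral_lborel_translate[of "\<lambda>x. h (f x)"]) auto
    then show "?g y * (\<integral>\<^sup>+x. h (f x) \<partial>lborel) = ?g y * (\<integral>\<^sup>+x. h (f x + y) \<partial>lborel)"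
      using z by (simp add: linear_add[OF f(1)])
  qed
  also have "\<dots> = (\<integral>\<^sup>+y. (\<integral>\<^sup>+x. ?g y * h (f x + y) \<partial>lborel) \<partial>lborel)"
    by (intro nn_integral_cong nn_integral_cmult[symmetric]) auto
  also have "\<dots> = (\<integral>\<^sup>+x. (\<integral>\<^sup>+y. ?g y * h (f x + y) \<partial>lborel) \<partial>lborel)"
    by (rule lborel_pair.Fubini') measurable
  also have "\<dots> = (\<integral>\<^sup>+x. (\<integral>\<^sup>+y. ?g (y - f x) * h y \<partial>lborel) \<partial>lborel)"
  proof (rule nn_integral_cong)
    fix x
    show "(\<integral>\<^sup>+y. ?g y * h (f x + y) \<partial>lborel) = (\<integral>\<^sup>+y. ?g (y - f x) * h y \<partial>lborel)"
      using nn_integral_lborel_translate[of "\<lambda>y. ?g (y - f x) * h y" "f x"] by (simp add: add.commute)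
  qed
  also have "\<dots> = (\<integral>\<^sup>+y. (\<integral>\<^sup>+x. ?g (y - f x) * h y \<partial>lborel) \<partial>lborel)"
    by (rule lborel_pair.Fubini') measurable
  also have "\<dots> = (\<integral>\<^sup>+y. (\<integral>\<^sup>+x. ?g (y - f x) \<partial>lborel) * h y \<partial>lborel)"
    by (intro nn_integral_cong nn_integral_multc) auto
  also have "\<dots> = (\<integral>\<^sup>+y. (\<integral>\<^sup>+x. ?g (f x) \<partial>lborel) * h y \<partial>lborel)"
  proof (rule nn_integral_cong)
    fix y :: 'a
    obtain z where z: "f z = y" using f(2) by (metis surjD)
    have "?g (y - f x) = ?g (f (x + - z))" for x
    proof -
      have "y - f x = - f (x + - z)" using z by (simp add: linear_diff[OF f(1)])
      then have "norm (y - f x) = norm (f (x + - z))" by simp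
      then show ?thesis using gauss_density_cong_norm by metis
    qed
    moreover have "(\<integral>\<^sup>+x. ?g (f (x + - z)) \<partial>lborel) = (\<integral>\<^sup>+x. ?g (f x) \<partial>lborel)"
      by (rule nn_integral_lborel_translate) measurable
    ultimately show "(\<integral>\<^sup>+x. ?g (y - f x) \<partial>lborel) * h y = (\<integral>\<^sup>+x. ?g (f x) \<partial>lborel) * h y"
      by simp
  qed
  also have "\<dots> = (\<integral>\<^sup>+x. ?g (f x) \<partial>lborel) * (\<integral>\<^sup>+x. h x \<partial>lborel)"
    by (rule nn_integral_cmult) auto
  finally show ?thesis .
qed

text \<open>The Gaussian integral of \<open>gauss_density (f x)\<close> stands in for 1 / |det f|;
  this is the multiplicativity of the determinant in that disguise.\<close>

lemma nn_integral_gauss_density_compose: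
  fixes f g :: "'a::euclidean_space \<Rightarrow> 'a"
  assumes f: "linear f" "surj f" and g: "linear g" "surj g"
  shows "(\<integral>\<^sup>+x. ennreal (gauss_density (f (g x))) \<partial>lborel)
       = (\<integral>\<^sup>+x. ennreal (gauss_density (f x)) \<partial>lborel) * (\<integral>\<^sup>+x. ennreal (gauss_density (g x)) \<partial>lborel)"
proof -
  have [measurable]: "f \<in> borel_measurable borel"
    using f(1) by (intro borel_measurable_continuous_onI linear_continuous_on linear_conv_bounded_linear[THEN iffD1])
  show ?thesis
    using nn_integral_lborel_linear[OF g, of "\<lambda>x. ennreal (gauss_density (f x))"]
    by (simp add: mult.commute)
qed

text \<open>The density depends on the norm alone, so the factor attached to an orthogonal map is
  the total Gaussian mass 1.\<close>

lemma nn_integral_std_gaussian_orthogonal: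
  fixes f :: "'a::euclidean_space \<Rightarrow> 'a" and h :: "'a \<Rightarrow> ennreal"
  assumes f: "orthogonal_transformation f" and [measurable]: "h \<in> borel_measurable borel"
  shows "(\<integral>\<^sup>+x. h (f x) \<partial>std_gaussian) = (\<integral>\<^sup>+x. h x \<partial>std_gaussian)"
proof -
  have lin: "linear f" "surj f"
    using f orthogonal_transformation_linear orthogonal_transformation_surj by blast+
  have [measurable]: "f \<in> borel_measurable borel"
    using lin(1) by (intro borel_measurable_continuous_onI linear_continuous_on linear_conv_bounded_linear[THEN iffD1])
  have *: "gauss_density (f x) = gauss_density x" for x
    by (intro gauss_density_cong_norm orthogonal_transformation_norm f)
  show ?thesis
    using nn_integral_lborel_linear[OF lin, of "\<lambda>x. ennreal (gauss_density x) * h x"]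
    by (simp add: * nn_integral_std_gaussian nn_integral_gauss_density)
qed

text \<open>The density is a product over coordinates and only the coordinate along \<open>e\<close>
  is stretched, so one factor changes, by the one-dimensional substitution.\<close>

lemma nn_integral_gauss_density_dilation_axis:
  fixes e :: "'a::euclidean_space"
  assumes e: "e \<in> Basis" and t: "t > 0"
  shows "(\<integral>\<^sup>+x. ennreal (gauss_density (x + ((t - 1) * (x \<bullet> e)) *\<^sub>R e)) \<partial>lborel) = ennreal (1 / t)"
proof -
  define c where "c b = (if b = e then t else 1)" for b :: 'a
  have coord: "(x + ((t - 1) * (x \<bullet> e)) *\<^sub>R e) \<bullet> b = c b * (x \<bullet> b)" if "b \<in> Basis" for x b
    using that e by (auto simp: c_def inner_add_left inner_Basis algebra_simps)
  have "(\<integral>\<^sup>+x. ennreal (gauss_density (x + ((t - 1) * (x \<bullet> e)) *\<^sub>R e)) \<partial>lborel)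
      = (\<integral>\<^sup>+x. (\<Prod>b\<in>Basis. ennreal (std_normal_density (c b * (x \<bullet> b)))) \<partial>lborel)"
    unfolding gauss_density_def
    by (intro nn_integral_cong) (subst prod_ennreal, auto simp: coord cong: prod.cong)
  also have "\<dots> = (\<Prod>b\<in>Basis. \<integral>\<^sup>+x. ennreal (std_normal_density (c b * x)) \<partial>lborel)"
    by (rule nn_integral_lborel_prod) auto
  also have "\<dots> = (\<Prod>b\<in>Basis. if b = e then ennreal (1 / t) else 1)"
  proof (rule prod.cong[OF refl])
    fix b :: 'a assume "b \<in> Basis"
    have "(\<integral>\<^sup>+x. ennreal (std_normal_density (t * x)) \<partial>lborel) = ennreal (1 / t)"
    proof -
      have "ennreal t * (\<integral>\<^sup>+x. ennreal (std_normal_density (t * x)) \<partial>lborel) = 1"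
        using nn_integral_real_affine[of "\<lambda>x. ennreal (std_normal_density x)" t 0] t
        by (simp add: nn_integral_std_normal_density)
      then have "ennreal (1 / t) * (ennreal t * (\<integral>\<^sup>+x. ennreal (std_normal_density (t * x)) \<partial>lborel)) = ennreal (1/t)"
        by simp
      then show ?thesis
        using t by (simp add: mult.assoc[symmetric] ennreal_mult[symmetric])
    qed
    then show "(\<integral>\<^sup>+x. ennreal (std_normal_density (c b * x)) \<partial>lborel) = (if b = e then ennreal (1 / t) else 1)"
      by (auto simp: c_def nn_integral_std_normal_density)
  qed
  also have "\<dots> = ennreal (1 / t)"
    using e by (simp add: prod.delta)
  finally show ?thesis .
qed

section \<open>Dilations along the span of an orthonormal set\<close>

text \<open>For orthonormal \<open>B\<close>: multiplication by \<open>t\<close> on the span of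
  \<open>B\<close>, identity on its orthogonal complement.\<close>

definition dilation :: "real \<Rightarrow> 'a::euclidean_space set \<Rightarrow> 'a \<Rightarrow> 'a" where
  "dilation t B x = x + (t - 1) *\<^sub>R (\<Sum>b\<in>B. (x \<bullet> b) *\<^sub>R b)"

lemma linear_dilation: "linear (dilation t B)"
proof (rule linearI)
  show "dilation t B (x + y) = dilation t B x + dilation t B y" for x y
    by (simp add: dilation_def inner_add_left scaleR_add_left sum.distrib scaleR_add_right)
  show "dilation t B (c *\<^sub>R x) = c *\<^sub>R dilation t B x" for c x
    by (simp add: dilation_def scaleR_add_right scaleR_sum_right mult.left_commute)
qed

lemma inner_orthonormal_sum:
  assumes "pairwise orthogonal B" "\<And>b. b \<in> B \<Longrightarrow> norm b = 1" "finite B" "b \<in> B"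
  shows "(\<Sum>c\<in>B. f c *\<^sub>R c) \<bullet> b = f b"
proof -
  have "(\<Sum>c\<in>B. f c *\<^sub>R c) \<bullet> b = (\<Sum>c\<in>B. if c = b then f b else 0)"
    unfolding inner_sum_left
    using assms by (intro sum.cong refl) (auto simp: pairwise_def orthogonal_def norm_eq_1)
  then show ?thesis using assms by simp
qed

lemma dilation_dilation:
  assumes "pairwise orthogonal B" "\<And>b. b \<in> B \<Longrightarrow> norm b = 1" "finite B"
  shows "dilation s B (dilation t B x) = dilation (s * t) B x"
proof -
  have "(\<Sum>b\<in>B. (dilation t B x \<bullet> b) *\<^sub>R b) = t *\<^sub>R (\<Sum>b\<in>B. (x \<bullet> b) *\<^sub>R b)"
    unfolding scaleR_sum_right
    by (intro sum.cong refl)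
       (simp add: dilation_def inner_add_left inner_orthonormal_sum[OF assms] algebra_simps)
  then show ?thesis
    by (simp add: dilation_def algebra_simps)
qed

lemma dilation_1 [simp]: "dilation 1 B x = x"
  by (simp add: dilation_def)

lemma surj_dilation:
  assumes "pairwise orthogonal B" "\<And>b. b \<in> B \<Longrightarrow> norm b = 1" "finite B" "t \<noteq> 0"
  shows "surj (dilation t B)"
  by (rule surjI[where f="dilation (1/t) B"]) (use assms in \<open>simp add: dilation_dilation\<close>)

text \<open>Pythagoras. The extra term, proportional to the squared norm of the projection, is what
  becomes the exponential weight under the Gaussian density.\<close>

lemma norm_dilation_squared:
  assumes "pairwise orthogonal B" "\<And>b. b \<in> B \<Longrightarrow> norm b = 1" "finite B"
  shows "(norm (dilation t B x))\<^sup>2 = (norm x)\<^sup>2 + (t\<^sup>2 - 1) * (norm (\<Sum>b\<in>B. (x \<bullet> b) *\<^sub>R b))\<^sup>2"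
proof -
  define p where "p = (\<Sum>b\<in>B. (x \<bullet> b) *\<^sub>R b)"
  have "x \<bullet> p = (\<Sum>b\<in>B. (x \<bullet> b)\<^sup>2)"
    by (simp add: p_def inner_sum_right power2_eq_square)
  moreover have "p \<bullet> p = (\<Sum>b\<in>B. (x \<bullet> b)\<^sup>2)"
  proof -
    have "p \<bullet> p = (\<Sum>b\<in>B. (x \<bullet> b) * (p \<bullet> b))"
      by (subst (2) p_def) (simp add: inner_sum_right)
    then show ?thesis
      by (simp add: p_def inner_orthonormal_sum[OF assms] power2_eq_square)
  qed
  ultimately have xp: "x \<bullet> p = p \<bullet> p" by simp
  show ?thesis
    unfolding dilation_def p_def[symmetric] power2_norm_eq_inner
    by (simp add: inner_add_left inner_add_right inner_commute[of p x] xp algebra_simps power2_eq_square)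
qed

text \<open>A dilation along \<open>B\<close> is a composition of dilations along its single
  vectors, and each of these is conjugate by a rotation to a dilation along a coordinate axis. Every
  vector contributes a factor \<open>1 / t\<close>.\<close>

lemma nn_integral_gauss_density_dilation:
  fixes B :: "(real^'n) set"
  assumes B: "pairwise orthogonal B" "\<And>b. b \<in> B \<Longrightarrow> norm b = 1" "finite B" and t: "t > 0"
  shows "(\<integral>\<^sup>+x. ennreal (gauss_density (dilation t B x)) \<partial>lborel) = ennreal ((1 / t) ^ card B)"
  using B(3,1,2)
proof (induction B rule: finite_induct)
  case empty
  then show ?case by (simp add: dilation_def nn_integral_gauss_density)
next
  case (insert b B)
  have b0: "x \<bullet> b = 0" if "x \<in> B" for x
    using insert that by (auto simp: pairwise_def orthogonal_def)
  have nb: "norm b = 1" using insert by auto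
  have BB: "pairwise orthogonal B" "\<And>b. b \<in> B \<Longrightarrow> norm b = 1"
    using insert by (auto simp: pairwise_insert)
  have sB: "pairwise orthogonal {b}" "\<And>c. c \<in> {b} \<Longrightarrow> norm c = 1" "finite {b}"
    using nb by auto
  have eq: "dilation t (insert b B) x = dilation t {b} (dilation t B x)" for x
  proof -
    have "(\<Sum>c\<in>B. (x \<bullet> c) *\<^sub>R c) \<bullet> b = 0"
      by (simp add: inner_sum_left b0)
    then show ?thesis
      using insert.hyps by (simp add: dilation_def inner_add_left algebra_simps)
  qed
  \<comment> \<open>Any coordinate axis will do as the one rotated onto \<open>b\<close>.\<close>
  obtain k :: 'n where True by auto
  obtain R where R: "orthogonal_transformation R" "R (axis k (1::real)) = b"
    by (rule orthogonal_transformation_exists_1[of "axis k 1" b]) (use nb in auto)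
  have linR: "linear R" "surj R"
    using R orthogonal_transformation_linear orthogonal_transformation_surj by blast+
  let ?D = "\<lambda>x. x + ((t - 1) * (x \<bullet> axis k 1)) *\<^sub>R (axis k 1 :: real^'n)"
  have inner_R: "R x \<bullet> b = x \<bullet> axis k 1" for x
    using R by (metis orthogonal_transformation_def)
  have D: "R (?D x) = dilation t {b} (R x)" for x
    using R(2) by (simp add: dilation_def linear_add[OF linR(1)] linear_scale[OF linR(1)] inner_R)
  have "(\<integral>\<^sup>+x. ennreal (gauss_density (dilation t {b} (R x))) \<partial>lborel) = (\<integral>\<^sup>+x. ennreal (gauss_density (?D x)) \<partial>lborel)"
    unfolding D[symmetric]
    by (intro nn_integral_cong arg_cong[where f=ennreal] gauss_density_cong_norm orthogonal_transformation_norm R(1))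
  also have "\<dots> = ennreal (1 / t)"
    by (rule nn_integral_gauss_density_dilation_axis) (use t in \<open>auto simp: axis_in_Basis_iff\<close>)
  finally have "(\<integral>\<^sup>+x. ennreal (gauss_density (dilation t {b} (R x))) \<partial>lborel) = ennreal (1 / t)" .
  moreover have "(\<integral>\<^sup>+x. ennreal (gauss_density (R x)) \<partial>lborel) = 1"
    using orthogonal_transformation_norm[OF R(1)] gauss_density_cong_norm[of "R _" _]
    by (simp add: nn_integral_gauss_density)
  ultimately have one: "(\<integral>\<^sup>+x. ennreal (gauss_density (dilation t {b} x)) \<partial>lborel) = ennreal (1 / t)"
    using nn_integral_gauss_density_compose[OF linear_dilation surj_dilation[OF sB] linR, of t] t by simp
  have "(\<integral>\<^sup>+x. ennreal (gauss_density (dilation t (insert b B) x)) \<partial>lborel) = ennreal (1 / t) * ennreal ((1 / t) ^ card B)"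
    unfolding eq
    using nn_integral_gauss_density_compose[OF linear_dilation surj_dilation[OF sB] linear_dilation surj_dilation[OF BB insert.hyps(1)], of t t] t
      one insert.IH[OF BB] by simp
  then show ?case
    using t insert.hyps by (simp add: ennreal_mult[symmetric])
qed

text \<open>The weight turns \<open>gauss_density x\<close> into
  \<open>gauss_density (dilation t B x)\<close>, and invariance lets the indicator of
  \<open>K\<close> be evaluated at the dilated point as well. The integrand is then a function of
  \<open>dilation t B x\<close>, and the change of variables yields the factor.\<close>

lemma dilation_invariant_set_laplace:
  fixes B :: "(real^'n) set"
  assumes B: "pairwise orthogonal B" "\<And>b. b \<in> B \<Longrightarrow> norm b = 1" "finite B"
    and K: "K \<in> sets borel" "\<And>x. dilation t B x \<in> K \<longleftrightarrow> x \<in> K" and t: "t > 0"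
  shows "(\<integral>\<^sup>+x. indicator K x * ennreal (exp (- (t\<^sup>2 - 1) * (norm (\<Sum>b\<in>B. (x \<bullet> b) *\<^sub>R b))\<^sup>2 / 2)) \<partial>std_gaussian)
       = ennreal ((1 / t) ^ card B) * emeasure std_gaussian K"
proof -
  note [measurable] = K(1)
  let ?P = "\<lambda>x. \<Sum>b\<in>B. (x \<bullet> b) *\<^sub>R b"
  have gd: "gauss_density x * exp (- (t\<^sup>2 - 1) * (norm (?P x))\<^sup>2 / 2) = gauss_density (dilation t B x)" for x
    unfolding gauss_density_eq
    by (simp add: mult.assoc mult_exp_exp norm_dilation_squared[OF B]) (simp add: field_simps)
  have "(\<integral>\<^sup>+x. indicator K x * ennreal (exp (- (t\<^sup>2 - 1) * (norm (?P x))\<^sup>2 / 2)) \<partial>std_gaussian)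
      = (\<integral>\<^sup>+x. ennreal (gauss_density x) * (indicator K x * ennreal (exp (- (t\<^sup>2 - 1) * (norm (?P x))\<^sup>2 / 2))) \<partial>lborel)"
    by (rule nn_integral_std_gaussian) measurable
  also have "\<dots> = (\<integral>\<^sup>+x. ennreal (gauss_density (dilation t B x)) * indicator K (dilation t B x) \<partial>lborel)"
  proof (rule nn_integral_cong)
    fix x
    have "ennreal (gauss_density x) * (indicator K x * ennreal (exp (- (t\<^sup>2 - 1) * (norm (?P x))\<^sup>2 / 2)))
        = ennreal (gauss_density x * exp (- (t\<^sup>2 - 1) * (norm (?P x))\<^sup>2 / 2)) * indicator K x"
      by (simp add: ennreal_mult mult_ac)
    then show "ennreal (gauss_density x) * (indicator K x * ennreal (exp (- (t\<^sup>2 - 1) * (norm (?P x))\<^sup>2 / 2)))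
        = ennreal (gauss_density (dilation t B x)) * indicator K (dilation t B x)"
      unfolding gd by (simp add: K(2) indicator_def)
  qed
  also have "\<dots> = (\<integral>\<^sup>+x. ennreal (gauss_density (dilation t B x)) \<partial>lborel) * (\<integral>\<^sup>+x. ennreal (gauss_density x) * indicator K x \<partial>lborel)"
    by (rule nn_integral_lborel_linear[where h="\<lambda>x. ennreal (gauss_density x) * indicator K x"])
       (use linear_dilation surj_dilation[OF B] t in auto)
  also have "(\<integral>\<^sup>+x. ennreal (gauss_density x) * indicator K x \<partial>lborel) = emeasure std_gaussian K"
    by (subst nn_integral_std_gaussian[symmetric]) auto
  finally show ?thesis
    by (simp add: nn_integral_gauss_density_dilation[OF B t])
qed

subsection \<open>Polyhedral cones\<close>

lemma convex_cone_closest_point_orthogonal: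
  fixes C :: "'a::euclidean_space set"
  assumes C: "convex_cone C" "closed C"
  shows "(g - closest_point C g) \<bullet> closest_point C g = 0"
    and "z \<in> C \<Longrightarrow> (g - closest_point C g) \<bullet> z \<le> 0"
proof -
  define p where "p = closest_point C g"
  have cv: "convex C" using C by (simp add: convex_cone_def)
  have p: "p \<in> C" unfolding p_def using C convex_cone_nonempty closest_point_in_set by blast
  have dot: "(g - p) \<bullet> (z - p) \<le> 0" if "z \<in> C" for z
    unfolding p_def using closest_point_dot[OF cv C(2) that] .
  \<comment> \<open>Testing the variational inequality at 0 and at \<open>2 *\<^sub>R p\<close>,
    both on the ray through \<open>p\<close>, gives the two signs of the inner product of
    \<open>g - p\<close> and \<open>p\<close>.\<close>
  have 0: "(g - p) \<bullet> (0 - p) \<le> 0" using dot C(1) convex_cone_contains_0 by blast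
  have 2: "(g - p) \<bullet> (2 *\<^sub>R p - p) \<le> 0" using dot p C(1) convex_cone_scaleR[of C 2 p] by simp
  show eq: "(g - closest_point C g) \<bullet> closest_point C g = 0"
    using 0 2 by (simp add: p_def[symmetric] inner_diff_right)
  show "(g - closest_point C g) \<bullet> z \<le> 0" if "z \<in> C"
    using dot[OF that] eq by (simp add: p_def[symmetric] inner_diff_right)
qed

text \<open>The converse of the previous facts (Moreau's characterization). The conditions involve
  \<open>g\<close> only through the residual \<open>g - p\<close>, which allows projections to be
  identified after a dilation.\<close>

lemma convex_cone_closest_point_unique:
  fixes C :: "'a::euclidean_space set"
  assumes C: "convex_cone C" "closed C" and p: "p \<in> C" "(g - p) \<bullet> p = 0" "\<And>z. z \<in> C \<Longrightarrow> (g - p) \<bullet> z \<le> 0"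
  shows "closest_point C g = p"
proof (rule closest_point_unique[symmetric])
  show "convex C" using C by (simp add: convex_cone_def)
  show "\<forall>z\<in>C. dist g p \<le> dist g z"
  proof
    fix z assume "z \<in> C"
    then have "0 \<le> (g - p) \<bullet> (p - z)" using p by (simp add: inner_diff_right)
    moreover have "(norm (g - z))\<^sup>2 = (norm (g - p))\<^sup>2 + 2 * ((g - p) \<bullet> (p - z)) + (norm (p - z))\<^sup>2"
      unfolding power2_norm_eq_inner by (simp add: inner_diff_left inner_diff_right inner_commute)
    ultimately have "(norm (g - p))\<^sup>2 \<le> (norm (g - z))\<^sup>2" by simp
    then show "dist g p \<le> dist g z" by (simp add: dist_norm)
  qed
qed (use C p in auto)

text \<open>A point \<open>x\<close> of the face lies strictly between \<open>c *\<^sub>R x\<close>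
  and another point of its ray, so the face property captures both endpoints.\<close>

lemma face_of_convex_cone:
  assumes "F face_of C" "convex_cone C" "F \<noteq> {}"
  shows "convex_cone F"
proof -
  have "conic F"
    unfolding conic_def
  proof (intro allI impI)
    fix x and c :: real assume x: "x \<in> F" and c: "0 \<le> c"
    have xC: "x \<in> C" using assms x face_of_imp_subset by blast
    show "c *\<^sub>R x \<in> F"
    proof (cases "x = 0 \<or> c = 1")
      case True then show ?thesis using x by auto
    next
      case False
      \<comment> \<open>The second endpoint is on the other side of \<open>x\<close>: twice
        \<open>x\<close> if the multiple is shorter, the origin if it is longer.\<close>
      define a where "a = (if c < 1 then 2 *\<^sub>R x else 0)"
      have "x \<in> open_segment (c *\<^sub>R x) a"
      proof (cases "c < 1")
        case True
        \<comment> \<open>The weight solves \<open>(1 - u) * c + u * 2 = 1\<close>.\<close>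
        have "x = (1 - (1 - c) / (2 - c)) *\<^sub>R (c *\<^sub>R x) + ((1 - c) / (2 - c)) *\<^sub>R (2 *\<^sub>R x)"
        proof -
          have "(1 - u) * c + u * 2 = 1" if "(2 - c) * u = 1 - c" for u
            using that by (simp add: algebra_simps)
          from this[of "(1 - c) / (2 - c)"] True
          have "(1 - (1 - c) / (2 - c)) * c + ((1 - c) / (2 - c)) * 2 = 1" by simp
          then show ?thesis by (metis scaleR_add_left scaleR_one scaleR_scaleR)
        qed
        moreover have "0 < (1 - c) / (2 - c)" "(1 - c) / (2 - c) < 1" using True c by (auto simp: field_simps)
        moreover have "c *\<^sub>R x \<noteq> 2 *\<^sub>R x" using True False by auto
        moreover have "a = 2 *\<^sub>R x" using True by (simp add: a_def)
        ultimately show ?thesis unfolding in_segment by blast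
      next
        case c1: False
        have "x = (1 - (1 - 1 / c)) *\<^sub>R (c *\<^sub>R x) + (1 - 1 / c) *\<^sub>R 0"
          using c1 by simp
        moreover have "0 < 1 - 1 / c" "1 - 1 / c < 1" using c1 False by (auto simp: field_simps)
        moreover have "c *\<^sub>R x \<noteq> 0" "a = 0" using c1 False by (auto simp: a_def)
        ultimately show ?thesis unfolding in_segment by metis
      qed
      moreover have "c *\<^sub>R x \<in> C" "a \<in> C"
        using xC assms(2) c by (auto simp: a_def convex_cone_iff)
      ultimately show ?thesis using face_ofD[OF assms(1)] x by blast
    qed
  qed
  then show ?thesis
    using assms face_of_imp_convex by (auto simp: convex_cone_def)
qed

text \<open>Take a face of least dimension containing \<open>x\<close>. If \<open>x\<close> were on
  its relative frontier, it would lie in a proper face of smaller dimension.\<close>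

lemma polyhedron_ex_face_rel_interior:
  fixes C :: "'a::euclidean_space set"
  assumes C: "polyhedron C" and x: "x \<in> C"
  shows "\<exists>F. F face_of C \<and> x \<in> rel_interior F"
proof -
  let ?P = "\<lambda>F. F face_of C \<and> x \<in> F"
  have "?P C" using C x by (simp add: polyhedron_imp_convex face_of_refl)
  then obtain F where F: "?P F" and min: "\<And>F'. ?P F' \<Longrightarrow> nat (aff_dim F) \<le> nat (aff_dim F')"
    using ex_has_least_nat[of ?P C "\<lambda>F. nat (aff_dim F)"] by blast
  have polyF: "polyhedron F" using C F face_of_polyhedron_polyhedron by blast
  have "x \<in> rel_interior F"
  proof (rule ccontr)
    assume "x \<notin> rel_interior F"
    then have "x \<in> rel_frontier F"
      using F closure_subset by (auto simp: rel_frontier_def)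
    then obtain F' where F': "F' face_of F" "F' \<noteq> F" "x \<in> F'"
      using rel_frontier_of_polyhedron_alt[OF polyF] by blast
    then have "aff_dim F' < aff_dim F"
      using face_of_aff_dim_lt polyF polyhedron_imp_convex by blast
    moreover have "0 \<le> aff_dim F'"
      using F'(3) aff_dim_geq[of F'] aff_dim_empty[of F'] by force
    ultimately show False
      using min[of F'] face_of_trans[OF F'(1)] F F'(3) by simp
  qed
  then show ?thesis using F by blast
qed

section \<open>Regions of points projected into one face\<close>

text \<open>For a nonempty face \<open>F\<close> of a closed convex cone this is the relative
  interior of \<open>F\<close> plus the normal cone of \<open>C\<close> at \<open>F\<close>.\<close>

definition face_region :: "'a::euclidean_space set \<Rightarrow> 'a set \<Rightarrow> 'a set" where
  "face_region C F = {g. closest_point C g \<in> rel_interior F}"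

lemma rel_interior_cone_scaleR:
  fixes F :: "'a::euclidean_space set"
  assumes F: "convex_cone F" and "p \<in> rel_interior F" "t > 0"
  shows "t *\<^sub>R p \<in> rel_interior F"
proof -
  have eq: "(*\<^sub>R) t ` F = F"
  proof
    show "(*\<^sub>R) t ` F \<subseteq> F" using F assms(3) by (auto intro: convex_cone_scaleR)
    show "F \<subseteq> (*\<^sub>R) t ` F"
    proof
      fix x assume "x \<in> F"
      then have "(1 / t) *\<^sub>R x \<in> F" using F assms(3) by (auto intro: convex_cone_scaleR)
      then have "t *\<^sub>R ((1 / t) *\<^sub>R x) \<in> (*\<^sub>R) t ` F" by (rule imageI)
      then show "x \<in> (*\<^sub>R) t ` F" using assms(3) by simp
    qed
  qed
  show ?thesis
    using rel_interior_scaleR[of t F] assms(2,3) unfolding eq by auto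
qed

text \<open>At a relative interior point of \<open>F\<close> one can move both ways within
  \<open>F\<close>, so the residual is orthogonal to all of \<open>F\<close>. The nonlinear
  projection onto \<open>C\<close> therefore agrees on this region with the linear projection onto
  the span of \<open>F\<close>.\<close>

lemma face_region_projection:
  fixes C :: "'a::euclidean_space set"
  assumes C: "convex_cone C" "closed C" and F: "F face_of C"
    and B: "pairwise orthogonal B" "\<And>b. b \<in> B \<Longrightarrow> norm b = 1" "finite B" "span B = span F"
    and g: "g \<in> face_region C F"
  shows "(\<Sum>b\<in>B. (g \<bullet> b) *\<^sub>R b) = closest_point C g"
proof -
  define p where "p = closest_point C g"
  have p: "p \<in> rel_interior F" using g by (simp add: face_region_def p_def)
  have pF: "p \<in> F" using p rel_interior_subset by blast
  have cF: "convex F" using F face_of_imp_convex C by (auto simp: convex_cone_def)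
  have "(g - p) \<bullet> z = 0" if z: "z \<in> F" for z
  proof -
    have zC: "z \<in> C" using z F face_of_imp_subset by blast
    have "F \<noteq> {}" using z by auto
    \<comment> \<open>This point of \<open>F\<close> lies beyond \<open>p\<close> on the line from
      \<open>z\<close>; testing there reverses the sign of the inequality for
      \<open>z\<close>.\<close>
    then obtain e where e: "e > 1" "(1 - e) *\<^sub>R z + e *\<^sub>R p \<in> F"
      using p z convex_rel_interior_iff[OF cF, of p] by blast
    then have "(1 - e) *\<^sub>R z + e *\<^sub>R p \<in> C" using F face_of_imp_subset by blast
    then have "(g - p) \<bullet> ((1 - e) *\<^sub>R z + e *\<^sub>R p) \<le> 0"
      using convex_cone_closest_point_orthogonal(2)[OF C] by (simp add: p_def)
    then have "(1 - e) * ((g - p) \<bullet> z) \<le> 0"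
      using convex_cone_closest_point_orthogonal(1)[OF C, of g] by (simp add: p_def inner_add_right)
    then have "0 \<le> (g - p) \<bullet> z" using e by (simp add: mult_le_0_iff)
    then show ?thesis
      using convex_cone_closest_point_orthogonal(2)[OF C zC, of g] by (simp add: p_def)
  qed
  then have orth: "(g - p) \<bullet> z = 0" if "z \<in> span F" for z
    using that orthogonal_to_span[of z F "g - p"] by (auto simp: orthogonal_def)
  have "p \<in> span B" using pF B span_base by auto
  then have "p = (\<Sum>b\<in>B. (p \<bullet> b) *\<^sub>R b)"
  proof -
    define q where "q = (\<Sum>b\<in>B. (p \<bullet> b) *\<^sub>R b)"
    have "(p - q) \<bullet> b = 0" if "b \<in> B" for b
      using inner_orthonormal_sum[OF B(1-3) that] by (simp add: q_def inner_diff_left)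
    then have *: "(p - q) \<bullet> z = 0" if "z \<in> span B" for z
      using that orthogonal_to_span[of z B "p - q"] by (auto simp: orthogonal_def)
    have "q \<in> span B" unfolding q_def by (intro span_sum span_scale span_base)
    then have "(p - q) \<bullet> (p - q) = 0"
      using * \<open>p \<in> span B\<close> span_diff by blast
    then show ?thesis by (simp add: q_def)
  qed
  moreover have "g \<bullet> b = p \<bullet> b" if "b \<in> B" for b
    using orth[of b] that B(4) span_base by (force simp: inner_diff_left)
  ultimately show ?thesis by (simp add: p_def)
qed

text \<open>The dilation multiplies the projection by \<open>t\<close> and leaves the residual
  alone, so the projection conditions survive, and relative interiors of cones are closed under
  positive scaling. The converse is the same with \<open>1 / t\<close>.\<close>

lemma face_region_dilation:
  fixes C :: "'a::euclidean_space set"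
  assumes C: "convex_cone C" "closed C" and F: "F face_of C"
    and B: "pairwise orthogonal B" "\<And>b. b \<in> B \<Longrightarrow> norm b = 1" "finite B" "span B = span F"
    and t: "t > 0"
  shows "dilation t B g \<in> face_region C F \<longleftrightarrow> g \<in> face_region C F"
proof -
  have imp: "dilation t B g \<in> face_region C F" if t: "t > 0" and g: "g \<in> face_region C F" for t g
  proof -
    define p where "p = closest_point C g"
    have p: "p \<in> rel_interior F" using g by (simp add: face_region_def p_def)
    then have pF: "p \<in> F" using rel_interior_subset by blast
    have ccF: "convex_cone F" using face_of_convex_cone F C pF by blast
    have d: "dilation t B g - t *\<^sub>R p = g - p"
      by (simp add: dilation_def face_region_projection[OF C F B g] p_def algebra_simps)
    have "closest_point C (dilation t B g) = t *\<^sub>R p"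
    proof (rule convex_cone_closest_point_unique[OF C])
      show "t *\<^sub>R p \<in> C" using pF F face_of_imp_subset C t by (meson convex_cone_scaleR less_imp_le subsetD)
      show "(dilation t B g - t *\<^sub>R p) \<bullet> (t *\<^sub>R p) = 0"
        using d convex_cone_closest_point_orthogonal(1)[OF C, of g] by (simp add: p_def)
      show "(dilation t B g - t *\<^sub>R p) \<bullet> z \<le> 0" if "z \<in> C" for z
        using d convex_cone_closest_point_orthogonal(2)[OF C that, of g] by (simp add: p_def)
    qed
    then show ?thesis
      using rel_interior_cone_scaleR[OF ccF p t] by (simp add: face_region_def)
  qed
  show ?thesis
  proof
    assume "dilation t B g \<in> face_region C F"
    then have "dilation (1 / t) B (dilation t B g) \<in> face_region C F" using imp t by simp
    then show "g \<in> face_region C F" using t by (simp add: dilation_dilation[OF B(1-3)])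
  qed (use imp t in auto)
qed

lemma borel_measurable_closest_point:
  fixes C :: "'a::euclidean_space set"
  assumes "convex C" "closed C" "C \<noteq> {}"
  shows "closest_point C \<in> borel_measurable borel"
  by (intro borel_measurable_continuous_onI continuous_on_closest_point assms)

lemma sets_face_region:
  fixes C :: "'a::euclidean_space set"
  assumes C: "convex C" "closed C" "C \<noteq> {}"
  shows "face_region C F \<in> sets borel"
proof -
  \<comment> \<open>A relative interior need not be open; as a difference of two closed sets it is
    still Borel.\<close>
  have "rel_interior F = closure F - rel_frontier F"
    using rel_interior_subset_closure by (auto simp: rel_frontier_def)
  then have "rel_interior F \<in> sets borel" by (auto intro!: borel_closed sets.Diff)
  from measurable_sets[OF borel_measurable_closest_point[OF C] this]
  show ?thesis by (simp add: face_region_def vimage_def)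
qed

text \<open>The regions of the nonempty faces partition the space. Each region of a
  \<open>k\<close>-dimensional face contributes its probability times \<open>(1 / t) ^ k\<close>,
  and grouping by dimension gives the polynomial in \<open>1 / t\<close>.\<close>

lemma polyhedral_intrinsic_volume_laplace:
  fixes C :: "(real^'n) set"
  assumes C: "polyhedral_cone C" and t: "t > 0"
  shows "(\<integral>\<^sup>+g. ennreal (exp (- (t\<^sup>2 - 1) * (norm (closest_point C g))\<^sup>2 / 2)) \<partial>std_gaussian)
       = ennreal (\<Sum>k=0..CARD('n). polyhedral_intrinsic_volume k C * (1 / t) ^ k)"
proof -
  interpret prob_space "std_gaussian :: (real^'n) measure" by (rule prob_space_std_gaussian)
  have cc: "convex_cone C" and pc: "polyhedron C" using C by (auto simp: polyhedral_cone_def)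
  have cl: "closed C" and cv: "convex C" and ne: "C \<noteq> {}"
    using pc cc polyhedron_imp_closed polyhedron_imp_convex convex_cone_nonempty by blast+
  define Fs where "Fs = {F. F face_of C \<and> F \<noteq> {}}"
  have finFs: "finite Fs"
    unfolding Fs_def by (rule finite_subset[OF _ finite_polyhedron_faces[OF pc]]) auto
  define E where "E g = exp (- (t\<^sup>2 - 1) * (norm (closest_point C g))\<^sup>2 / 2)" for g
  note sets_face_region[OF cv cl ne, measurable] borel_measurable_closest_point[OF cv cl ne, measurable]
  have uniq: "F = F'" if "F \<in> Fs" "F' \<in> Fs" "g \<in> face_region C F" "g \<in> face_region C F'" for F F' g
    using that face_of_eq unfolding Fs_def face_region_def by blast
  have ex: "\<exists>F\<in>Fs. g \<in> face_region C F" for g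
    using polyhedron_ex_face_rel_interior[OF pc closest_point_in_set[OF cl ne, of g]]
    by (force simp: Fs_def face_region_def)
  have ind: "(\<Sum>F\<in>Fs. indicator (face_region C F) g) = (1::ennreal)" for g
  proof -
    obtain F where F: "F \<in> Fs" "g \<in> face_region C F" using ex by blast
    then have "(\<Sum>F'\<in>Fs. indicator (face_region C F') g) = (\<Sum>F'\<in>Fs. if F' = F then 1 else (0::ennreal))"
      using uniq by (intro sum.cong refl) (auto simp: indicator_def)
    then show ?thesis using F finFs by simp
  qed
  \<comment> \<open>A nonempty face is a cone through the origin, so the affine dimension in the
    definition of the volumes equals the linear dimension that appears as the exponent.\<close>
  have dimF: "aff_dim F = int (dim F)" if "F \<in> Fs" for F
    using that face_of_convex_cone[OF _ cc] convex_cone_contains_0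
    by (intro aff_dim_zero hull_inc) (auto simp: Fs_def)
  have face: "(\<integral>\<^sup>+g. indicator (face_region C F) g * ennreal (E g) \<partial>std_gaussian)
      = ennreal ((1 / t) ^ dim F * prob (face_region C F))" if F: "F \<in> Fs" for F
  proof -
    have FC: "F face_of C" using F by (simp add: Fs_def)
    obtain B where B: "B \<subseteq> span F" "pairwise orthogonal B" "\<And>b. b \<in> B \<Longrightarrow> norm b = 1"
      "independent B" "card B = dim (span F)" "span B = span F"
      using orthonormal_basis_subspace[OF subspace_span] by metis
    have finB: "finite B" using B independent_imp_finite by blast
    have "indicator (face_region C F) g * ennreal (E g)
        = indicator (face_region C F) g * ennreal (exp (- (t\<^sup>2 - 1) * (norm (\<Sum>b\<in>B. (g \<bullet> b) *\<^sub>R b))\<^sup>2 / 2))" for g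
      using face_region_projection[OF cc cl FC B(2,3) finB B(6)]
      by (cases "g \<in> face_region C F") (auto simp: E_def)
    then have "(\<integral>\<^sup>+g. indicator (face_region C F) g * ennreal (E g) \<partial>std_gaussian)
        = ennreal ((1 / t) ^ dim F) * emeasure std_gaussian (face_region C F)"
      using dilation_invariant_set_laplace[OF B(2,3) finB _ face_region_dilation[OF cc cl FC B(2,3) finB B(6) t] t]
        B(5) by simp
    then show ?thesis
      using t by (simp add: emeasure_eq_measure ennreal_mult)
  qed
  have vk: "polyhedral_intrinsic_volume k C = (\<Sum>F | F \<in> Fs \<and> dim F = k. prob (face_region C F))" for k
  proof -
    have "{g. \<exists>F. F face_of C \<and> aff_dim F = int k \<and> closest_point C g \<in> rel_interior F}
        = (\<Union>F\<in>{F. F \<in> Fs \<and> dim F = k}. face_region C F)"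
      using dimF by (fastforce simp: face_region_def Fs_def)
    moreover have "prob (\<Union>F\<in>{F. F \<in> Fs \<and> dim F = k}. face_region C F)
        = (\<Sum>F | F \<in> Fs \<and> dim F = k. prob (face_region C F))"
      using finFs uniq by (intro finite_measure_finite_Union) (auto simp: disjoint_family_on_def)
    ultimately show ?thesis by (simp add: polyhedral_intrinsic_volume_def)
  qed
  have "(\<integral>\<^sup>+g. ennreal (E g) \<partial>std_gaussian)
      = (\<integral>\<^sup>+g. (\<Sum>F\<in>Fs. indicator (face_region C F) g * ennreal (E g)) \<partial>std_gaussian)"
    by (simp add: sum_distrib_right[symmetric] ind)
  also have "\<dots> = (\<Sum>F\<in>Fs. \<integral>\<^sup>+g. indicator (face_region C F) g * ennreal (E g) \<partial>std_gaussian)"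
    by (rule nn_integral_sum) (simp add: E_def)
  also have "\<dots> = ennreal (\<Sum>F\<in>Fs. (1 / t) ^ dim F * prob (face_region C F))"
    using t by (simp add: face sum_nonneg)
  also have "(\<Sum>F\<in>Fs. (1 / t) ^ dim F * prob (face_region C F))
      = (\<Sum>k=0..CARD('n). \<Sum>F | F \<in> Fs \<and> dim F = k. (1 / t) ^ dim F * prob (face_region C F))"
    using dim_subset_UNIV_cart finFs
    by (intro sum.group[symmetric]) auto
  also have "\<dots> = (\<Sum>k=0..CARD('n). polyhedral_intrinsic_volume k C * (1 / t) ^ k)"
    by (simp add: vk sum_distrib_left mult.commute)
  finally show ?thesis by (simp add: E_def)
qed

subsection \<open>Projection norms and approximation of cones\<close>

lemma bdd_above_inner_image:
  fixes A :: "'a::real_inner set"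
  assumes "bounded A"
  shows "bdd_above ((\<lambda>y. y \<bullet> g) ` A)"
proof -
  obtain M where M: "\<And>y. y \<in> A \<Longrightarrow> norm y \<le> M" using assms bounded_iff by blast
  show ?thesis
  proof (rule bdd_aboveI2)
    fix y assume "y \<in> A"
    then have "norm y * norm g \<le> M * norm g" using M by (intro mult_right_mono) auto
    then show "y \<bullet> g \<le> M * norm g" using norm_cauchy_schwarz[of y g] by linarith
  qed
qed

text \<open>Replacing a point of \<open>A\<close> by one of \<open>B\<close> changes its inner
  product with \<open>g\<close> by at most \<open>norm g\<close> times their distance.\<close>

lemma SUP_inner_le_hausdorff:
  fixes A B :: "'a::euclidean_space set"
  assumes A: "bounded A" "A \<noteq> {}" and B: "bounded B" "B \<noteq> {}"
  shows "(SUP y\<in>A. y \<bullet> g) \<le> (SUP y\<in>B. y \<bullet> g) + norm g * hausdorff_dist A B"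
proof (rule cSUP_least[OF A(2)])
  fix x assume x: "x \<in> A"
  define s where "s = (SUP y\<in>B. y \<bullet> g)"
  have "x \<bullet> g \<le> s + norm g * infdist x B"
  proof (cases "g = 0")
    case True then show ?thesis using B by (simp add: s_def)
  next
    case False
    \<comment> \<open>Dividing by \<open>norm g\<close> isolates the distance, so the bound, valid
      for every \<open>b\<close>, passes to the infimum over \<open>B\<close>.\<close>
    have "(x \<bullet> g - s) / norm g \<le> infdist x B"
      unfolding infdist_notempty[OF B(2)]
    proof (rule cINF_greatest[OF B(2)])
      fix b assume b: "b \<in> B"
      have "x \<bullet> g - b \<bullet> g \<le> dist x b * norm g"
        using norm_cauchy_schwarz[of "x - b" g] by (simp add: inner_diff_left dist_norm)
      moreover have "b \<bullet> g \<le> s" unfolding s_def by (rule cSUP_upper[OF b bdd_above_inner_image[OF B(1)]])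
      ultimately have "x \<bullet> g - s \<le> dist x b * norm g" by linarith
      then show "(x \<bullet> g - s) / norm g \<le> dist x b" using False by (simp add: field_simps)
    qed
    then show ?thesis using False by (simp add: field_simps)
  qed
  moreover have "infdist x B \<le> hausdorff_dist A B"
  proof -
    have "bdd_above ((\<lambda>x. infdist x B) ` A)"
    proof -
      obtain b where b: "b \<in> B" using B by auto
      have "bounded (A \<union> {b})" using A by simp
      then obtain e where e: "\<And>x y. x \<in> A \<union> {b} \<Longrightarrow> y \<in> A \<union> {b} \<Longrightarrow> dist x y \<le> e"
        using bounded_two_points by meson
      show ?thesis by (rule bdd_aboveI2[of _ _ e]) (use e b in \<open>auto intro!: infdist_le2\<close>)
    qed
    then show ?thesis
      using A B x by (auto simp: hausdorff_dist_def intro!: max.coboundedI1 cSUP_upper)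
  qed
  ultimately show "x \<bullet> g \<le> s + norm g * hausdorff_dist A B"
    using mult_left_mono[of "infdist x B" "hausdorff_dist A B" "norm g"] by simp
qed

lemma hausdorff_dist_commute: "hausdorff_dist A B = hausdorff_dist B A"
  by (auto simp: hausdorff_dist_def max.commute)

lemma SUP_inner_hausdorff:
  fixes A B :: "'a::euclidean_space set"
  assumes "bounded A" "A \<noteq> {}" "bounded B" "B \<noteq> {}"
  shows "\<bar>(SUP y\<in>A. y \<bullet> g) - (SUP y\<in>B. y \<bullet> g)\<bar> \<le> norm g * hausdorff_dist A B"
  using SUP_inner_le_hausdorff[OF assms, of g] SUP_inner_le_hausdorff[OF assms(3,4,1,2), of g]
  by (auto simp: hausdorff_dist_commute)

text \<open>For closed convex cones this is the norm of the metric projection; unlike the projection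
  itself, it is visibly continuous in the conic Hausdorff distance. The case distinction avoids \<^const>\<open>Sup\<close> of the
  empty set.\<close>

definition cone_projection_norm :: "'a::euclidean_space set \<Rightarrow> 'a \<Rightarrow> real" where
  "cone_projection_norm C g =
     (if C \<inter> sphere 0 1 = {} then 0 else max 0 (SUP y\<in>C \<inter> sphere 0 1. y \<bullet> g))"

lemma bounded_Int_sphere:
  fixes C :: "'a::euclidean_space set"
  shows "bounded (C \<inter> sphere a r)"
  by (rule bounded_subset[OF compact_imp_bounded[OF compact_sphere]]) auto

lemma SUP_inner_sphere_le_norm:
  fixes C :: "'a::euclidean_space set"
  assumes "C \<inter> sphere 0 1 \<noteq> {}"
  shows "\<bar>SUP y\<in>C \<inter> sphere 0 1. y \<bullet> g\<bar> \<le> norm g"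
proof -
  have *: "\<bar>y \<bullet> g\<bar> \<le> norm g" if "y \<in> C \<inter> sphere 0 1" for y
    using Cauchy_Schwarz_ineq2[of y g] that by simp
  obtain y where y: "y \<in> C \<inter> sphere 0 1" using assms by blast
  have "y \<bullet> g \<le> (SUP y\<in>C \<inter> sphere 0 1. y \<bullet> g)"
    by (rule cSUP_upper[OF y bdd_above_inner_image[OF bounded_Int_sphere]])
  moreover have "(SUP y\<in>C \<inter> sphere 0 1. y \<bullet> g) \<le> norm g"
    by (rule cSUP_least[OF assms]) (use * in fastforce)
  ultimately show ?thesis using *[OF y] by linarith
qed

text \<open>A supremum of 1-Lipschitz functions is 1-Lipschitz.\<close>

lemma continuous_SUP_inner_sphere:
  fixes C :: "'a::euclidean_space set"
  assumes ne: "C \<inter> sphere 0 1 \<noteq> {}"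
  shows "continuous_on UNIV (\<lambda>g. SUP y\<in>C \<inter> sphere 0 1. y \<bullet> g)"
proof -
  have le: "(SUP y\<in>C \<inter> sphere 0 1. y \<bullet> g) \<le> (SUP y\<in>C \<inter> sphere 0 1. y \<bullet> g') + dist g g'" for g g' :: 'a
  proof (rule cSUP_least[OF ne])
    fix y assume y: "y \<in> C \<inter> sphere 0 1"
    have "y \<bullet> g' \<le> (SUP y\<in>C \<inter> sphere 0 1. y \<bullet> g')"
      by (rule cSUP_upper[OF y bdd_above_inner_image[OF bounded_Int_sphere]])
    moreover have "y \<bullet> (g - g') \<le> dist g g'"
      using norm_cauchy_schwarz[of y "g - g'"] y by (simp add: dist_norm)
    ultimately show "y \<bullet> g \<le> (SUP y\<in>C \<inter> sphere 0 1. y \<bullet> g') + dist g g'"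
      by (simp add: inner_diff_right)
  qed
  show ?thesis
  proof (rule continuous_onI)
    fix e :: real and x :: 'a assume "e > 0"
    have "dist (SUP y\<in>C \<inter> sphere 0 1. y \<bullet> x') (SUP y\<in>C \<inter> sphere 0 1. y \<bullet> x) \<le> dist x' x" for x'
      using le[of x x'] le[of x' x] by (simp add: dist_real_def dist_commute abs_le_iff)
    then show "\<exists>d>0. \<forall>x'\<in>UNIV. dist x' x < d \<longrightarrow>
        dist (SUP y\<in>C \<inter> sphere 0 1. y \<bullet> x') (SUP y\<in>C \<inter> sphere 0 1. y \<bullet> x) \<le> e"
      using \<open>e > 0\<close> by (meson less_imp_le order_trans)
  qed
qed

lemma continuous_cone_projection_norm: "continuous_on UNIV (cone_projection_norm C)"
proof (cases "C \<inter> sphere 0 1 = {}")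
  case False
  then show ?thesis
    unfolding cone_projection_norm_def[abs_def]
    by (simp add: continuous_on_max continuous_SUP_inner_sphere)
qed (simp add: cone_projection_norm_def[abs_def])

lemma borel_measurable_cone_projection_norm [measurable]:
  "cone_projection_norm C \<in> borel_measurable borel"
  by (intro borel_measurable_continuous_onI continuous_cone_projection_norm)

lemma cone_projection_norm_nonneg: "0 \<le> cone_projection_norm C g"
  by (simp add: cone_projection_norm_def)

lemma cone_projection_norm_le: "cone_projection_norm C g \<le> norm g"
  using SUP_inner_sphere_le_norm[of C g] by (cases "C \<inter> sphere 0 1 = {}") (simp_all add: cone_projection_norm_def)

text \<open>For unit vectors \<open>y\<close> of the cone, the inner product with \<open>g\<close>
  is at most that with the projection \<open>p\<close>, hence at most \<open>norm p\<close>; the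
  direction of \<open>p\<close> attains equality. If \<open>p = 0\<close>, the supremum is
  nonpositive and \<open>max\<close> with 0 takes over.\<close>

lemma norm_closest_point_convex_cone:
  fixes C :: "'a::euclidean_space set"
  assumes C: "convex_cone C" "closed C"
  shows "norm (closest_point C g) = cone_projection_norm C g"
proof -
  define p where "p = closest_point C g"
  have p: "p \<in> C" unfolding p_def using C convex_cone_nonempty closest_point_in_set by blast
  have eq: "(g - p) \<bullet> p = 0" and le: "\<And>z. z \<in> C \<Longrightarrow> (g - p) \<bullet> z \<le> 0"
    using convex_cone_closest_point_orthogonal[OF C] by (auto simp: p_def)
  let ?A = "C \<inter> sphere 0 1"
  have pA: "p /\<^sub>R norm p \<in> ?A" if "p \<noteq> 0"
    using that p convex_cone_scaleR[OF C(1)] by auto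
  show ?thesis
  proof (cases "?A = {}")
    case True
    then have "p = 0" using pA by auto
    then show ?thesis using True by (simp add: cone_projection_norm_def p_def)
  next
    case False
    have "(SUP y\<in>?A. y \<bullet> g) \<le> norm p"
    proof (rule cSUP_least[OF False])
      fix y assume y: "y \<in> ?A"
      then have "y \<bullet> g \<le> y \<bullet> p" using le[of y] by (simp add: inner_diff_left inner_commute[of y])
      also have "\<dots> \<le> norm p" using norm_cauchy_schwarz[of y p] y by simp
      finally show "y \<bullet> g \<le> norm p" .
    qed
    moreover have "norm p \<le> (SUP y\<in>?A. y \<bullet> g)" if "p \<noteq> 0"
    proof -
      have "(p /\<^sub>R norm p) \<bullet> g = norm p"
        using eq that by (simp add: inner_diff_left inner_commute[of p g] dot_square_norm power2_eq_square)
      then show ?thesis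
        using cSUP_upper[OF pA[OF that] bdd_above_inner_image[OF bounded_Int_sphere], of g] by simp
    qed
    ultimately show ?thesis
      using False norm_ge_zero[of p]
      by (cases "p = 0") (simp_all add: cone_projection_norm_def p_def[symmetric] max_def)
  qed
qed

lemma cone_projection_norm_tendsto:
  fixes C :: "'a::euclidean_space set"
  assumes lim: "(\<lambda>i. conic_hausdorff_dist (P i) C) \<longlonglongrightarrow> 0"
  shows "(\<lambda>i. cone_projection_norm (P i) g) \<longlonglongrightarrow> cone_projection_norm C g"
proof -
  have "\<bar>cone_projection_norm (P i) g - cone_projection_norm C g\<bar> \<le> norm g * conic_hausdorff_dist (P i) C"
    if "conic_hausdorff_dist (P i) C < 1" for i
  proof -
    let ?A = "P i \<inter> sphere 0 1" and ?B = "C \<inter> sphere 0 1"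
    \<comment> \<open>A distance below 1 rules out that exactly one slice is empty, the case to
      which \<open>hausdorff_dist\<close> assigns the value 1.\<close>
    have "?A = {} \<longleftrightarrow> ?B = {}"
      using that by (auto simp: conic_hausdorff_dist_def hausdorff_dist_def split: if_splits)
    then consider "?A = {}" "?B = {}" | "?A \<noteq> {}" "?B \<noteq> {}" by blast
    then show ?thesis
    proof cases
      case 1
      then show ?thesis by (simp add: cone_projection_norm_def conic_hausdorff_dist_def hausdorff_dist_def)
    next
      case 2
      then show ?thesis
        using SUP_inner_hausdorff[OF bounded_Int_sphere 2(1) bounded_Int_sphere 2(2), of g]
        by (simp add: cone_projection_norm_def conic_hausdorff_dist_def)
    qed
  qed
  moreover have "eventually (\<lambda>i. conic_hausdorff_dist (P i) C < 1) sequentially"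
    using order_tendstoD(2)[OF lim] by simp
  ultimately have "eventually (\<lambda>i. norm (cone_projection_norm (P i) g - cone_projection_norm C g)
      \<le> norm g * conic_hausdorff_dist (P i) C) sequentially"
    by (auto elim: eventually_mono)
  moreover have "(\<lambda>i. norm g * conic_hausdorff_dist (P i) C) \<longlonglongrightarrow> 0"
    using tendsto_mult_right_zero[OF lim] .
  ultimately have "(\<lambda>i. cone_projection_norm (P i) g - cone_projection_norm C g) \<longlonglongrightarrow> 0"
    by (rule Lim_null_comparison)
  then show ?thesis by (simp add: LIM_zero_iff)
qed

text \<open>The conic hull of a finite net of the spherical slice lies inside \<open>C\<close>, so
  one of the two one-sided distances vanishes and the other is at most the mesh of the net.\<close>

lemma ex_polyhedral_cone_approx:
  fixes C :: "'a::euclidean_space set"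
  assumes C: "convex_cone C" "closed C"
  shows "\<exists>P. (\<forall>i::nat. polyhedral_cone (P i)) \<and> (\<lambda>i. conic_hausdorff_dist (P i) C) \<longlonglongrightarrow> 0"
proof (cases "C \<inter> sphere 0 1 = {}")
  case True
  have "polyhedral_cone {0::'a}"
    using polyhedron_convex_cone_hull[of "{}::'a set"] by (simp add: polyhedral_cone_def)
  moreover have "conic_hausdorff_dist {0} C = 0"
    using True by (simp add: conic_hausdorff_dist_def hausdorff_dist_def)
  ultimately show ?thesis by (intro exI[of _ "\<lambda>i. {0}"]) simp
next
  case ne: False
  let ?A = "C \<inter> sphere 0 1"
  have "compact ?A" using C by (simp add: closed_Int_compact)
  have "\<exists>P. polyhedral_cone P \<and> \<bar>conic_hausdorff_dist P C\<bar> \<le> 1 / real (Suc i)" for i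
  proof -
    define e where "e = 1 / real (Suc i)"
    have e: "e > 0" by (simp add: e_def)
    obtain K where K: "finite K" "K \<subseteq> ?A" "?A \<subseteq> (\<Union>x\<in>K. ball x e)"
      using compactE_image[OF \<open>compact ?A\<close>, of ?A "\<lambda>x. ball x e"] e
      by (metis (no_types, lifting) UN_I centre_in_ball open_ball subsetI)
    define P where "P = convex_cone hull K"
    have PC: "P \<subseteq> C" unfolding P_def using K C by (intro hull_minimal) auto
    have KP: "K \<subseteq> P \<inter> sphere 0 1" unfolding P_def using K hull_subset[of K convex_cone] by auto
    have Kne: "K \<noteq> {}" using K ne by auto
    have Pne: "P \<inter> sphere 0 1 \<noteq> {}" using Kne KP by blast
    have "(SUP x\<in>P \<inter> sphere 0 1. infdist x ?A) = (SUP x\<in>P \<inter> sphere 0 1. 0)"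
      using PC by (intro SUP_cong refl) auto
    then have 1: "(SUP x\<in>P \<inter> sphere 0 1. infdist x ?A) = 0" using Pne by simp
    have 2: "(SUP y\<in>?A. infdist y (P \<inter> sphere 0 1)) \<le> e"
    proof (rule cSUP_least[OF ne])
      fix y assume "y \<in> ?A"
      then obtain x where "x \<in> K" "dist x y < e" using K(3) by auto
      then show "infdist y (P \<inter> sphere 0 1) \<le> e" using KP by (intro infdist_le2[of x]) (auto simp: dist_commute)
    qed
    have "polyhedral_cone P"
      unfolding P_def polyhedral_cone_def using polyhedron_convex_cone_hull[OF K(1)] convex_cone_convex_cone_hull by blast
    moreover have "\<bar>conic_hausdorff_dist P C\<bar> \<le> e"
      using 1 2 ne Pne e by (simp add: conic_hausdorff_dist_def hausdorff_dist_def)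
    ultimately show ?thesis unfolding e_def by blast
  qed
  then obtain P where P: "\<And>i. polyhedral_cone (P i)" "\<And>i. \<bar>conic_hausdorff_dist (P i) C\<bar> \<le> 1 / real (Suc i)"
    by metis
  have "(\<lambda>i. conic_hausdorff_dist (P i) C) \<longlonglongrightarrow> 0"
    by (rule Lim_null_comparison[of _ "\<lambda>i. 1 / real (Suc i)"])
       (use P(2) lim_1_over_n LIMSEQ_Suc[OF lim_1_over_n] in auto)
  then show ?thesis using P(1) by blast
qed

section \<open>Recovering polynomial coefficients from values\<close>

text \<open>The weight \<open>c q k\<close> is the coefficient of degree \<open>k\<close> in the
  Lagrange basis polynomial at the node \<open>q\<close>. The weights are chosen before
  \<open>a\<close>: coefficients are fixed linear combinations of values, so limits of values become
  limits of coefficients.\<close>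

lemma lagrange_coefficients:
  fixes Q :: "real set"
  assumes Q: "finite Q" "card Q = Suc d"
  shows "\<exists>c. \<forall>a k. k \<le> d \<longrightarrow> a k = (\<Sum>q\<in>Q. (\<Sum>i=0..d. a i * q ^ i) * c q k)"
proof -
  define l where "l q = (\<Prod>r\<in>Q - {q}. smult (1 / (q - r)) [:- r, 1:])" for q
  have poly_l: "poly (l q) r = (if r = q then 1 else 0)" if "q \<in> Q" "r \<in> Q" for q r
  proof (cases "r = q")
    case True
    have "(1 / (q - s)) * (q - s) = 1" if "s \<in> Q - {q}" for s
      using that by auto
    then show ?thesis
      using True by (simp add: l_def poly_prod) (simp add: diff_divide_distrib[symmetric])
  next
    case False
    then show ?thesis using that Q by (auto simp: l_def poly_prod prod_zero_iff)
  qed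
  have deg_l: "degree (l q) \<le> d" if "q \<in> Q" for q
  proof -
    have "degree (l q) \<le> (\<Sum>r\<in>Q - {q}. degree (smult (1 / (q - r)) [:- r, 1:]))"
      unfolding l_def using Q by (intro order.trans[OF degree_prod_sum_le]) (auto simp: o_def)
    also have "\<dots> \<le> (\<Sum>r\<in>Q - {q}. 1)" by (intro sum_mono order.trans[OF degree_smult_le]) auto
    also have "\<dots> = d" using that Q by simp
    finally show ?thesis .
  qed
  have "a k = (\<Sum>q\<in>Q. (\<Sum>i=0..d. a i * q ^ i) * coeff (l q) k)" if "k \<le> d" for a :: "nat \<Rightarrow> real" and k
  proof -
    define p where "p = (\<Sum>i=0..d. monom (a i) i)"
    have pp: "poly p q = (\<Sum>i=0..d. a i * q ^ i)" for q by (simp add: p_def poly_sum poly_monom)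
    have "p = (\<Sum>q\<in>Q. smult (poly p q) (l q))"
    proof (rule poly_eqI_degree[of Q])
      show "poly p x = poly (\<Sum>q\<in>Q. smult (poly p q) (l q)) x" if "x \<in> Q" for x
      proof -
        have "poly (\<Sum>q\<in>Q. smult (poly p q) (l q)) x = (\<Sum>q\<in>Q. if q = x then poly p x else 0)"
          unfolding poly_sum using that by (intro sum.cong refl) (simp add: poly_l)
        then show ?thesis using that Q by simp
      qed
      have "degree p \<le> d" unfolding p_def
        by (intro degree_sum_le) (auto intro: order.trans[OF degree_monom_le])
      then show "degree p < card Q" using Q by simp
      have "degree (\<Sum>q\<in>Q. smult (poly p q) (l q)) \<le> d"
        using Q deg_l by (intro degree_sum_le order.trans[OF degree_smult_le]) auto
      then show "degree (\<Sum>q\<in>Q. smult (poly p q) (l q)) < card Q" using Q by simp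
    qed
    then have "coeff p k = (\<Sum>q\<in>Q. poly p q * coeff (l q) k)"
      by (metis (no_types, lifting) coeff_sum coeff_smult sum.cong)
    moreover have "coeff p k = a k"
      using that by (simp add: p_def coeff_sum)
    ultimately show ?thesis by (simp add: pp)
  qed
  then show ?thesis by (intro exI[of _ "\<lambda>q. coeff (l q)"] allI impI)
qed

subsection \<open>Intrinsic volumes and statistical dimension\<close>

lemma nn_integral_std_gaussian_inner_squared:
  fixes b :: "'a::euclidean_space"
  assumes b: "b \<in> Basis"
  shows "(\<integral>\<^sup>+x. ennreal ((x \<bullet> b)\<^sup>2) \<partial>std_gaussian) = 1"
proof -
  define f where "f c = (\<lambda>x::real. if c = b then ennreal (std_normal_density x * x\<^sup>2) else ennreal (std_normal_density x))" for c :: 'a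
  have "(\<integral>\<^sup>+x. ennreal ((x \<bullet> b)\<^sup>2) \<partial>std_gaussian)
      = (\<integral>\<^sup>+x. ennreal (gauss_density x) * ennreal ((x \<bullet> b)\<^sup>2) \<partial>lborel)"
    by (rule nn_integral_std_gaussian) measurable
  also have "\<dots> = (\<integral>\<^sup>+x. (\<Prod>c\<in>Basis. f c (x \<bullet> c)) \<partial>lborel)"
  proof (rule nn_integral_cong)
    fix x :: 'a
    have "ennreal (gauss_density x) = (\<Prod>c\<in>Basis. ennreal (std_normal_density (x \<bullet> c)))"
      by (simp add: gauss_density_def prod_ennreal)
    also have "\<dots> = ennreal (std_normal_density (x \<bullet> b)) * (\<Prod>c\<in>Basis - {b}. ennreal (std_normal_density (x \<bullet> c)))"
      using b by (simp add: prod.remove)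
    finally have 1: "ennreal (gauss_density x) = \<dots>" .
    have "(\<Prod>c\<in>Basis. f c (x \<bullet> c)) = f b (x \<bullet> b) * (\<Prod>c\<in>Basis - {b}. f c (x \<bullet> c))"
      using b by (simp add: prod.remove)
    also have "(\<Prod>c\<in>Basis - {b}. f c (x \<bullet> c)) = (\<Prod>c\<in>Basis - {b}. ennreal (std_normal_density (x \<bullet> c)))"
      by (intro prod.cong refl) (auto simp: f_def)
    finally show "ennreal (gauss_density x) * ennreal ((x \<bullet> b)\<^sup>2) = (\<Prod>c\<in>Basis. f c (x \<bullet> c))"
      unfolding 1 by (simp add: f_def ennreal_mult mult_ac)
  qed
  also have "\<dots> = (\<Prod>c\<in>Basis. \<integral>\<^sup>+x. f c x \<partial>lborel)"
    by (rule nn_integral_lborel_prod) (auto simp: f_def)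
  also have "\<dots> = 1"
  proof (rule prod.neutral, rule ballI)
    fix c :: 'a
    have "(\<integral>\<^sup>+x. ennreal (std_normal_density x * x\<^sup>2) \<partial>lborel) = ennreal (\<integral>x. std_normal_density x * x\<^sup>2 \<partial>lborel)"
      using integrable_std_normal_moment[of 2] by (intro nn_integral_eq_integral) auto
    also have "\<dots> = 1" using integral_std_normal_moment_even[of 1] by simp
    finally show "(\<integral>\<^sup>+x. f c x \<partial>lborel) = 1"
      by (cases "c = b") (simp_all add: f_def nn_integral_std_normal_density)
  qed
  finally show ?thesis .
qed

lemma integrable_std_gaussian_norm_squared:
  "integrable std_gaussian (\<lambda>x::'a::euclidean_space. (norm x)\<^sup>2)"
proof (rule integrableI_nonneg)
  have eq: "(norm x)\<^sup>2 = (\<Sum>b\<in>Basis. (x \<bullet> b)\<^sup>2)" for x :: 'a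
    unfolding power2_norm_eq_inner by (subst euclidean_inner) (simp add: power2_eq_square)
  have "(\<integral>\<^sup>+x. ennreal ((norm (x::'a))\<^sup>2) \<partial>std_gaussian) = (\<integral>\<^sup>+x. (\<Sum>b\<in>Basis. ennreal (((x::'a) \<bullet> b)\<^sup>2)) \<partial>std_gaussian)"
    by (simp add: eq)
  also have "\<dots> = (\<Sum>b\<in>Basis. \<integral>\<^sup>+x. ennreal (((x::'a) \<bullet> b)\<^sup>2) \<partial>std_gaussian)"
    by (rule nn_integral_sum) auto
  also have "\<dots> < \<infinity>"
    by (simp add: nn_integral_std_gaussian_inner_squared of_nat_less_top)
  finally show "(\<integral>\<^sup>+x. ennreal ((norm (x::'a))\<^sup>2) \<partial>std_gaussian) < \<infinity>" .
qed auto

lemma integrable_std_gaussian_norm: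
  "integrable std_gaussian (\<lambda>x::'a::euclidean_space. norm x)"
proof -
  interpret prob_space "std_gaussian :: 'a measure" by (rule prob_space_std_gaussian)
  show ?thesis
    by (rule square_integrable_imp_integrable) (auto intro: integrable_std_gaussian_norm_squared)
qed

lemma integral_std_gaussian_inner:
  fixes y :: "'a::euclidean_space"
  shows "integrable std_gaussian (\<lambda>x. y \<bullet> x)" "(\<integral>x. y \<bullet> x \<partial>std_gaussian) = 0"
proof -
  have "integrable std_gaussian (\<lambda>x. norm y * norm x)"
    by (intro integrable_mult_right integrable_std_gaussian_norm)
  then show int: "integrable std_gaussian (\<lambda>x. y \<bullet> x)"
    by (rule Bochner_Integration.integrable_bound) (auto simp: Cauchy_Schwarz_ineq2)
  \<comment> \<open>The law is invariant under reflection in the origin, so the mean equals its own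
    negative.\<close>
  have o: "orthogonal_transformation (uminus :: 'a \<Rightarrow> 'a)"
    by (simp add: orthogonal_transformation_def linear_uminus)
  have "distr std_gaussian borel uminus = (std_gaussian :: 'a measure)"
  proof (rule measure_eqI)
    fix A :: "'a set" assume "A \<in> sets (distr std_gaussian borel uminus)"
    then have [measurable]: "A \<in> sets borel" by simp
    show "emeasure (distr std_gaussian borel uminus) A = emeasure std_gaussian A"
      using nn_integral_std_gaussian_orthogonal[OF o, of "indicator A"]
      by (simp add: nn_integral_distr flip: nn_integral_indicator)
  qed simp
  then have "(\<integral>x. y \<bullet> x \<partial>std_gaussian) = (\<integral>x. y \<bullet> x \<partial>distr std_gaussian borel uminus)" by simp
  also have "\<dots> = (\<integral>x. - (y \<bullet> x) \<partial>std_gaussian)" by (subst integral_distr) auto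
  also have "\<dots> = - (\<integral>x. y \<bullet> x \<partial>std_gaussian)" by simp
  finally show "(\<integral>x. y \<bullet> x \<partial>std_gaussian) = 0" by simp
qed

section \<open>The Laplace transform of the squared projection norm\<close>

text \<open>The Laplace transform of the squared projection norm at
  \<open>(t\<^sup>2 - 1) / 2\<close>. This parametrization makes it a polynomial in
  \<open>1 / t\<close> for polyhedral cones and puts the trivial value 1 at
  \<open>t = 1\<close>.\<close>

definition cone_laplace :: "'a::euclidean_space set \<Rightarrow> real \<Rightarrow> real" where
  "cone_laplace C t = (\<integral>g. exp (- (t\<^sup>2 - 1) * (cone_projection_norm C g)\<^sup>2 / 2) \<partial>std_gaussian)"

lemma cone_laplace_polyhedral:
  fixes C :: "(real^'n) set"
  assumes C: "polyhedral_cone C" and t: "t > 0"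
  shows "cone_laplace C t = (\<Sum>k=0..CARD('n). polyhedral_intrinsic_volume k C * (1 / t) ^ k)"
proof -
  have cc: "convex_cone C" "closed C"
    using C polyhedron_imp_closed by (auto simp: polyhedral_cone_def)
  have nonneg: "0 \<le> polyhedral_intrinsic_volume k C" for k by (simp add: polyhedral_intrinsic_volume_def)
  have "cone_laplace C t = enn2real (\<integral>\<^sup>+g. ennreal (exp (- (t\<^sup>2 - 1) * (cone_projection_norm C g)\<^sup>2 / 2)) \<partial>std_gaussian)"
    unfolding cone_laplace_def by (rule integral_eq_nn_integral) auto
  then show ?thesis
    using polyhedral_intrinsic_volume_laplace[OF C t] t nonneg
    by (simp add: norm_closest_point_convex_cone[OF cc] sum_nonneg)
qed

lemma cone_laplace_tendsto:
  fixes C :: "'a::euclidean_space set"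
  assumes "(\<lambda>i. conic_hausdorff_dist (P i) C) \<longlonglongrightarrow> 0" "t \<ge> 1"
  shows "(\<lambda>i. cone_laplace (P i) t) \<longlonglongrightarrow> cone_laplace C t"
  unfolding cone_laplace_def
proof (rule integral_dominated_convergence[where w="\<lambda>_. 1"])
  interpret prob_space "std_gaussian :: 'a measure" by (rule prob_space_std_gaussian)
  show "integrable (std_gaussian :: 'a measure) (\<lambda>_. 1 :: real)" by simp
  show "AE g in std_gaussian. (\<lambda>i. exp (- (t\<^sup>2 - 1) * (cone_projection_norm (P i) g)\<^sup>2 / 2))
      \<longlonglongrightarrow> exp (- (t\<^sup>2 - 1) * (cone_projection_norm C g)\<^sup>2 / 2)"
    by (intro AE_I2 tendsto_intros cone_projection_norm_tendsto assms) auto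
  have "1 \<le> t\<^sup>2" using assms(2) by simp
  then show "AE g in std_gaussian. norm (exp (- (t\<^sup>2 - 1) * (cone_projection_norm (P i) g)\<^sup>2 / 2)) \<le> 1" for i
    by (intro AE_I2) (simp add: mult_nonpos_nonneg)
qed measurable

text \<open>Along any polyhedral approximation, interpolation expresses each volume by values of
  \<open>cone_laplace\<close>, whose limits depend on \<open>C\<close> alone. This identifies the
  \<open>THE\<close> in \<open>intrinsic_volume\<close>, after which the polyhedral identity passes
  to the limit along \<open>P0\<close>.\<close>

lemma intrinsic_volume_laplace:
  fixes C :: "(real^'n) set"
  assumes approx: "\<forall>i. polyhedral_cone (P0 i)" "(\<lambda>i. conic_hausdorff_dist (P0 i) C) \<longlonglongrightarrow> 0" and t: "t \<ge> 1"
  shows "cone_laplace C t = (\<Sum>k=0..CARD('n). intrinsic_volume k C * (1 / t) ^ k)"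
proof -
  let ?d = "CARD('n)"
  \<comment> \<open>These nodes correspond to \<open>t\<close> = 1, 2, ..., \<open>?d + 1\<close>:
    one more than the degree, all in the range where limits are available.\<close>
  define Q where "Q = (\<lambda>j. 1 / real (Suc j)) ` {..?d}"
  have Q: "finite Q" "card Q = Suc ?d"
    unfolding Q_def by (auto simp: card_image inj_on_def)
  have Q1: "1 / q \<ge> 1" "q > 0" if "q \<in> Q" for q using that by (auto simp: Q_def)
  obtain c where c: "\<And>(a::nat\<Rightarrow>real) k. k \<le> ?d \<Longrightarrow> a k = (\<Sum>q\<in>Q. (\<Sum>i=0..?d. a i * q ^ i) * c q k)"
    using lagrange_coefficients[OF Q] by metis
  define v where "v k = (\<Sum>q\<in>Q. cone_laplace C (1 / q) * c q k)" for k
  have lim: "(\<lambda>i. polyhedral_intrinsic_volume k (P i)) \<longlonglongrightarrow> v k"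
    if P: "\<forall>i. polyhedral_cone (P i)" "(\<lambda>i. conic_hausdorff_dist (P i) C) \<longlonglongrightarrow> 0" and k: "k \<le> ?d" for P k
  proof -
    have "polyhedral_intrinsic_volume k (P i) = (\<Sum>q\<in>Q. cone_laplace (P i) (1 / q) * c q k)" for i
      using c[OF k, of "\<lambda>k. polyhedral_intrinsic_volume k (P i)"] P(1) Q1
      by (simp add: cone_laplace_polyhedral)
    then show ?thesis
      unfolding v_def by (simp, intro tendsto_intros cone_laplace_tendsto P Q1)
  qed
  have iv: "intrinsic_volume k C = v k" if k: "k \<le> ?d" for k
    unfolding intrinsic_volume_def
  proof (rule the_equality)
    show "\<forall>P. (\<forall>i. polyhedral_cone (P i)) \<and> (\<lambda>i. conic_hausdorff_dist (P i) C) \<longlonglongrightarrow> 0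
        \<longrightarrow> (\<lambda>i. polyhedral_intrinsic_volume k (P i)) \<longlonglongrightarrow> v k"
      using lim k by blast
    \<comment> \<open>The given sequence \<open>P0\<close> makes the condition on \<open>w\<close>
      nonvacuous and so forces uniqueness.\<close>
    show "w = v k" if "\<forall>P. (\<forall>i. polyhedral_cone (P i)) \<and> (\<lambda>i. conic_hausdorff_dist (P i) C) \<longlonglongrightarrow> 0
        \<longrightarrow> (\<lambda>i. polyhedral_intrinsic_volume k (P i)) \<longlonglongrightarrow> w" for w
      using that lim[OF approx k] approx LIMSEQ_unique by blast
  qed
  have "(\<lambda>i. cone_laplace (P0 i) t) \<longlonglongrightarrow> (\<Sum>k=0..?d. v k * (1 / t) ^ k)"
    using t approx(1) by (simp add: cone_laplace_polyhedral) (intro tendsto_intros lim approx, simp)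
  then have "cone_laplace C t = (\<Sum>k=0..?d. v k * (1 / t) ^ k)"
    using cone_laplace_tendsto[OF approx(2) t] LIMSEQ_unique by blast
  then show ?thesis by (simp add: iv)
qed

lemma DERIV_sequence_limit:
  fixes f :: "real \<Rightarrow> real"
  assumes "(f has_real_derivative D) (at 1)"
  shows "(\<lambda>n. (f (1 + 1 / real (Suc n)) - f 1) * real (Suc n)) \<longlonglongrightarrow> D"
proof -
  have "((\<lambda>h. (f (1 + h) - f 1) / h) \<longlongrightarrow> D) (at 0)"
    using assms by (simp add: DERIV_def)
  moreover have "filterlim (\<lambda>n. 1 / real (Suc n)) (at 0) sequentially"
    using LIMSEQ_Suc[OF lim_1_over_n] by (intro filterlim_atI) auto
  ultimately have "(\<lambda>n. (f (1 + 1 / real (Suc n)) - f 1) / (1 / real (Suc n))) \<longlonglongrightarrow> D"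
    by (rule filterlim_compose)
  then show ?thesis by simp
qed

text \<open>Both sides of the Laplace identity are differentiated at \<open>t = 1\<close> from the
  right: \<open>(1 / t) ^ k\<close> contributes \<open>- k\<close> and the exponential minus the
  squared projection norm.\<close>

lemma sum_intrinsic_volume_eq:
  fixes C :: "(real^'n) set"
  assumes approx: "\<forall>i. polyhedral_cone (P0 i)" "(\<lambda>i. conic_hausdorff_dist (P0 i) C) \<longlonglongrightarrow> 0"
  shows "(\<Sum>k=0..CARD('n). real k * intrinsic_volume k C) = (\<integral>g. (cone_projection_norm C g)\<^sup>2 \<partial>std_gaussian)"
proof -
  interpret prob_space "std_gaussian :: (real^'n) measure" by (rule prob_space_std_gaussian)
  let ?t = "\<lambda>n. 1 + 1 / real (Suc n)"
  let ?E = "\<lambda>t y. exp (- (t\<^sup>2 - 1) * y / 2) :: real"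
  let ?N = "\<lambda>g. (cone_projection_norm C g)\<^sup>2"
  have int: "integrable std_gaussian (\<lambda>g. ?E t (?N g))" if "t \<ge> 1" for t
  proof (rule integrable_const_bound[where B=1])
    have "1 \<le> t\<^sup>2" using that by simp
    then show "AE g in std_gaussian. norm (?E t (?N g)) \<le> 1"
      by (intro AE_I2) (simp add: mult_nonpos_nonneg)
  qed measurable
  have "(\<lambda>n. (\<integral>g. (?E (?t n) (?N g) - 1) * real (Suc n) \<partial>std_gaussian)) \<longlonglongrightarrow> (\<integral>g. - ?N g \<partial>std_gaussian)"
  proof (rule integral_dominated_convergence[where w="\<lambda>g. 2 * (norm g)\<^sup>2"])
    show "integrable std_gaussian (\<lambda>g::real^'n. 2 * (norm g)\<^sup>2)"
      by (intro integrable_mult_right integrable_std_gaussian_norm_squared)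
    show "AE g in std_gaussian. (\<lambda>n. (?E (?t n) (?N g) - 1) * real (Suc n)) \<longlonglongrightarrow> - ?N g"
    proof (rule AE_I2)
      fix g
      have "((\<lambda>t. ?E t (?N g)) has_real_derivative - ?N g) (at 1)"
        by (auto intro!: derivative_eq_intros)
      from DERIV_sequence_limit[OF this] show "(\<lambda>n. (?E (?t n) (?N g) - 1) * real (Suc n)) \<longlonglongrightarrow> - ?N g"
        by simp
    qed
    show "AE g in std_gaussian. norm ((?E (?t n) (?N g) - 1) * real (Suc n)) \<le> 2 * (norm g)\<^sup>2" for n
    proof (rule AE_I2)
      fix g :: "real^'n"
      define y where "y = ?N g"
      define h where "h = 1 / real (Suc n)"
      have h: "0 < h" "h \<le> 1" "real (Suc n) = 1 / h" by (auto simp: h_def)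
      have y: "0 \<le> y" "y \<le> (norm g)\<^sup>2"
        unfolding y_def by (auto intro!: power_mono cone_projection_norm_le cone_projection_norm_nonneg)
      \<comment> \<open>At \<open>t = 1 + h\<close> the exponent is \<open>- u\<close>. From
        \<open>1 - exp (- u) \<le> u\<close> and \<open>u / h = (2 + h) * y / 2\<close> the
        difference quotient is at most \<open>2 * y\<close>, uniformly in \<open>n\<close>.\<close>
      define u where "u = ((1 + h)\<^sup>2 - 1) * y / 2"
      define w where "w = (2 + h) * y / 2"
      have "u = h * w" by (simp add: u_def w_def power2_eq_square algebra_simps)
      moreover have "w \<le> 2 * y" using h y mult_right_mono[of "2 + h" 4 y] by (simp add: w_def)
      moreover have "0 \<le> w" using h y by (simp add: w_def)
      ultimately have u: "0 \<le> u" "u \<le> h * (2 * y)" using h by (auto intro: mult_left_mono)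
      have "1 - u \<le> exp (- u)" using exp_ge_add_one_self[of "-u"] by simp
      then have "\<bar>exp (- u) - 1\<bar> \<le> h * (2 * y)" using u by simp
      then have "\<bar>exp (- u) - 1\<bar> * (1 / h) \<le> 2 * y" using h by (simp add: field_simps)
      then have "norm ((exp (- u) - 1) * (1 / h)) \<le> 2 * (norm g)\<^sup>2"
        using h y by (simp add: abs_mult)
      moreover have "- u = - ((1 + h)\<^sup>2 - 1) * y / 2" by (simp add: u_def left_diff_distrib diff_divide_distrib)
      ultimately show "norm ((?E (?t n) (?N g) - 1) * real (Suc n)) \<le> 2 * (norm g)\<^sup>2"
        unfolding y_def[symmetric] h_def[symmetric] unfolding h(3) by (simp only:)
    qed
  qed measurable
  moreover have "(\<integral>g. (?E (?t n) (?N g) - 1) * real (Suc n) \<partial>std_gaussian)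
      = (cone_laplace C (?t n) - cone_laplace C 1) * real (Suc n)" for n
    using int[of "?t n"] by (simp add: cone_laplace_def prob_space)
  ultimately have 1: "(\<lambda>n. (cone_laplace C (?t n) - cone_laplace C 1) * real (Suc n)) \<longlonglongrightarrow> - (\<integral>g. ?N g \<partial>std_gaussian)"
    by simp
  let ?S = "\<lambda>t. \<Sum>k=0..CARD('n). intrinsic_volume k C * (1 / t) ^ k"
  have "(?S has_real_derivative (\<Sum>k=0..CARD('n). intrinsic_volume k C * (- real k))) (at 1)"
  proof (rule DERIV_sum)
    show "((\<lambda>t. intrinsic_volume k C * (1 / t) ^ k) has_real_derivative intrinsic_volume k C * (- real k)) (at 1)" for k
      by (auto intro!: derivative_eq_intros)
  qed
  from DERIV_sequence_limit[OF this]
  have "(\<lambda>n. (cone_laplace C (?t n) - cone_laplace C 1) * real (Suc n)) \<longlonglongrightarrow> (\<Sum>k=0..CARD('n). intrinsic_volume k C * (- real k))"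
    by (simp add: intrinsic_volume_laplace[OF approx])
  from LIMSEQ_unique[OF this 1]
  have "(\<Sum>k=0..CARD('n). intrinsic_volume k C * real k) = (\<integral>g. ?N g \<partial>std_gaussian)"
    by (simp add: sum_negf)
  then show ?thesis by (simp add: mult.commute)
qed

subsection \<open>The Gaussian Poincare inequality\<close>

definition std_normal :: "real measure" where
  "std_normal = density lborel (\<lambda>x. ennreal (std_normal_density x))"

lemma sets_std_normal [simp, measurable_cong]: "sets std_normal = sets borel"
  by (simp add: std_normal_def)

lemma space_std_normal [simp]: "space std_normal = UNIV"
  by (simp add: std_normal_def)

lemma prob_space_std_normal: "prob_space std_normal"
  unfolding std_normal_def by (rule prob_space_normal_density) simp

lemma nn_integral_std_normal:
  "h \<in> borel_measurable borel \<Longrightarrow>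
    (\<integral>\<^sup>+x. h x \<partial>std_normal) = (\<integral>\<^sup>+x. ennreal (std_normal_density x) * h x \<partial>lborel)"
  unfolding std_normal_def by (subst nn_integral_density) auto

lemma integral_std_normal:
  fixes h :: "real \<Rightarrow> real"
  shows "h \<in> borel_measurable borel \<Longrightarrow>
    (\<integral>x. h x \<partial>std_normal) = (\<integral>x. std_normal_density x * h x \<partial>lborel)"
  unfolding std_normal_def by (subst integral_density) auto

lemma integrable_std_normal_id: "integrable std_normal (\<lambda>x. x)"
  unfolding std_normal_def using integrable_std_normal_moment[of 1]
  by (subst integrable_density) auto

text \<open>The function \<open>- std_normal_density\<close> is an antiderivative of
  \<open>x\<close> times the density, and it vanishes at infinity.\<close>

lemma integral_std_normal_tail:
  "(\<integral>x. x * indicator {u<..} x \<partial>std_normal) = std_normal_density u"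
proof -
  have der: "((\<lambda>x. - std_normal_density x) has_real_derivative std_normal_density x * x) (at x)" for x
    unfolding std_normal_density_def by (auto intro!: derivative_eq_intros simp: field_simps)
  have lim: "((\<lambda>x. - std_normal_density x) \<longlongrightarrow> 0) at_top"
    unfolding std_normal_density_def by real_asymp
  have cont: "isCont std_normal_density x" for x
    unfolding std_normal_density_def[abs_def] by (intro continuous_intros) auto
  have "(LINT x=ereal u..\<infinity>|lborel. (std_normal_density x * x)) = 0 - (- std_normal_density u)"
  proof (rule interval_integral_FTC_integrable[where F="\<lambda>x. - std_normal_density x"])
    show "((\<lambda>x. - std_normal_density x) has_vector_derivative std_normal_density x * x) (at x)" for x
      using der by (simp add: has_real_derivative_iff_has_vector_derivative)
    show "isCont (\<lambda>x. std_normal_density x * x) x" for x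
      by (intro continuous_intros cont)
    show "set_integrable lborel (einterval (ereal u) \<infinity>) (\<lambda>x. std_normal_density x * x)"
      using integrable_std_normal_moment[of 1] unfolding set_integrable_def
      by (intro integrable_mult_indicator) auto
    show "(((\<lambda>x. - std_normal_density x) \<circ> real_of_ereal) \<longlongrightarrow> - std_normal_density u) (at_right (ereal u))"
      unfolding ereal_tendsto_simps
      using cont[of u] by (intro tendsto_minus) (simp add: isCont_def filterlim_at_split)
    show "(((\<lambda>x. - std_normal_density x) \<circ> real_of_ereal) \<longlongrightarrow> 0) (at_left \<infinity>)"
      unfolding ereal_tendsto_simps by (rule lim)
  qed simp
  then show ?thesis
    by (simp add: interval_integral_to_infinity_eq set_lebesgue_integral_def integral_std_normal mult_ac)
qed

text \<open>On \<open>x \<le> u < y\<close> split \<open>y - x\<close> as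
  \<open>(y - u) + (u - x)\<close>; each part separates into a product of one-variable integrals.
  With \<open>q\<close> the upper tail probability these are \<open>density - u * q\<close> and that
  plus \<open>u\<close>, and the combination weighted by \<open>1 - q\<close> and \<open>q\<close>
  collapses to the density.\<close>

lemma std_normal_kernel:
  "(\<integral>\<^sup>+x. \<integral>\<^sup>+y. ennreal (y - x) * (indicator {..u} x * indicator {u<..} y) \<partial>std_normal \<partial>std_normal)
    = ennreal (std_normal_density u)"
proof -
  interpret prob_space std_normal by (rule prob_space_std_normal)
  define q where "q = prob {u<..}"
  have ind_int: "integrable std_normal (indicator A :: real \<Rightarrow> real)" if "A \<in> sets borel" for A
    using that by (simp add: integrable_indicator_iff less_top[symmetric])
  have xi: "integrable std_normal (\<lambda>x. x * indicator {u<..} x)"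
    by (intro integrable_mult_indicator[where 'b=real, simplified, unfolded mult.commute[of "indicator _ _"]] integrable_std_normal_id) simp
  let ?a = "\<lambda>y. (y - u) * indicator {u<..} y" and ?b = "\<lambda>x. (u - x) * indicator {..u} x :: real"
  have eqa: "?a y = y * indicator {u<..} y - u * indicator {u<..} y" for y :: real
    by (simp add: algebra_simps)
  have inta: "integrable std_normal ?a"
    unfolding eqa by (intro Bochner_Integration.integrable_diff xi integrable_mult_right ind_int) simp
  have a: "(\<integral>y. ?a y \<partial>std_normal) = std_normal_density u - u * q"
    unfolding eqa by (subst Bochner_Integration.integral_diff)
      (auto intro!: xi ind_int integrable_mult_right simp: integral_std_normal_tail q_def)
  have nna: "(\<integral>\<^sup>+y. ennreal (?a y) \<partial>std_normal) = ennreal (\<integral>y. ?a y \<partial>std_normal)"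
    by (intro nn_integral_eq_integral inta AE_I2) (simp add: indicator_def)
  \<comment> \<open>The negative part of \<open>x - u\<close> is its positive part minus
    \<open>x - u\<close>, so only the upper tail has to be integrated.\<close>
  have eqb: "?b x = ?a x - (x - u)" for x by (auto simp: indicator_def)
  have intb: "integrable std_normal ?b"
    unfolding eqb by (intro Bochner_Integration.integrable_diff inta integrable_std_normal_id) simp
  have nnb: "(\<integral>\<^sup>+x. ennreal (?b x) \<partial>std_normal) = ennreal (\<integral>x. ?b x \<partial>std_normal)"
    by (intro nn_integral_eq_integral intb AE_I2) (simp add: indicator_def)
  have mean: "(\<integral>x. x \<partial>std_normal) = 0"
    using integral_std_normal_moment_odd[of 0] by (simp add: integral_std_normal)
  have b: "(\<integral>x. ?b x \<partial>std_normal) = std_normal_density u - u * q + u"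
  proof -
    have "(\<integral>x. ?b x \<partial>std_normal) = (\<integral>x. ?a x \<partial>std_normal) - (\<integral>x. x - u \<partial>std_normal)"
      unfolding eqb by (rule Bochner_Integration.integral_diff) (auto intro!: inta integrable_std_normal_id)
    also have "(\<integral>x. x - u \<partial>std_normal) = - u"
      using integrable_std_normal_id by (simp add: mean prob_space[simplified])
    finally show ?thesis using a by simp
  qed
  have p: "prob {..u} = 1 - q"
  proof -
    have "{..u} = UNIV - {u<..}" by auto
    then show ?thesis using prob_compl[of "{u<..}"] by (simp add: q_def)
  qed
  have "(\<integral>\<^sup>+y. ennreal (y - x) * (indicator {..u} x * indicator {u<..} y) \<partial>std_normal)
      = ennreal (?b x) * ennreal q + indicator {..u} x * ennreal (\<integral>y. ?a y \<partial>std_normal)" for x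
  proof -
    have "ennreal (y - x) * (indicator {..u} x * indicator {u<..} y)
        = ennreal (?b x) * indicator {u<..} y + indicator {..u} x * ennreal (?a y)" for y
      by (auto simp: indicator_def ennreal_plus[symmetric] simp del: ennreal_plus)
    then show ?thesis
      by (simp add: nn_integral_add nn_integral_cmult q_def emeasure_eq_measure nna)
  qed
  then have "(\<integral>\<^sup>+x. \<integral>\<^sup>+y. ennreal (y - x) * (indicator {..u} x * indicator {u<..} y) \<partial>std_normal \<partial>std_normal)
      = (\<integral>\<^sup>+x. ennreal (?b x) * ennreal q + indicator {..u} x * ennreal (\<integral>y. ?a y \<partial>std_normal) \<partial>std_normal)"
    by simp
  also have "\<dots> = ennreal (\<integral>x. ?b x \<partial>std_normal) * ennreal q + ennreal (1 - q) * ennreal (\<integral>y. ?a y \<partial>std_normal)"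
    by (simp add: nn_integral_add nn_integral_multc emeasure_eq_measure p nnb)
  also have "\<dots> = ennreal ((\<integral>x. ?b x \<partial>std_normal) * q + (1 - q) * (\<integral>y. ?a y \<partial>std_normal))"
  proof -
    have "0 \<le> (\<integral>x. ?b x \<partial>std_normal)" "0 \<le> (\<integral>y. ?a y \<partial>std_normal)"
      by (auto intro!: integral_nonneg_AE simp: indicator_def)
    moreover have "0 \<le> q" "q \<le> 1" by (auto simp: q_def)
    ultimately show ?thesis by (simp add: ennreal_mult[symmetric] ennreal_plus[symmetric] del: ennreal_plus)
  qed
  also have "(\<integral>x. ?b x \<partial>std_normal) * q + (1 - q) * (\<integral>y. ?a y \<partial>std_normal) = std_normal_density u"
    unfolding a b by (simp add: algebra_simps)
  finally show ?thesis .
qed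

text \<open>Two independent copies of \<open>F\<close>. The right-hand side is a nonnegative
  integral so that increments can be bounded pointwise and integrals exchanged freely.\<close>

lemma (in prob_space) variance_doubling:
  fixes F :: "'a \<Rightarrow> real"
  assumes [measurable]: "F \<in> borel_measurable M" and bd: "\<And>x. x \<in> space M \<Longrightarrow> \<bar>F x\<bar> \<le> B"
  shows "ennreal (2 * ((\<integral>x. (F x)\<^sup>2 \<partial>M) - (\<integral>x. F x \<partial>M)\<^sup>2)) = (\<integral>\<^sup>+x. \<integral>\<^sup>+y. ennreal ((F x - F y)\<^sup>2) \<partial>M \<partial>M)"
proof -
  have i1: "integrable M F" by (rule integrable_const_bound[where B=B]) (use bd in auto)
  have "\<bar>F x\<bar>\<^sup>2 \<le> B\<^sup>2" if "x \<in> space M" for x by (intro power_mono bd that) simp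
  then have i2: "integrable M (\<lambda>x. (F x)\<^sup>2)" by (intro integrable_const_bound[where B="B\<^sup>2"]) auto
  let ?m = "\<integral>x. F x \<partial>M" and ?s = "\<integral>x. (F x)\<^sup>2 \<partial>M"
  have sq: "(F x - F y)\<^sup>2 = (F x)\<^sup>2 - 2 * F x * F y + (F y)\<^sup>2" for x y
    by (simp add: power2_diff)
  have id: "integrable M (\<lambda>y. (F x - F y)\<^sup>2)" for x
    unfolding sq using i1 i2 by simp
  have in1: "(\<integral>\<^sup>+y. ennreal ((F x - F y)\<^sup>2) \<partial>M) = ennreal ((F x)\<^sup>2 - 2 * F x * ?m + ?s)" for x
  proof -
    have "(\<integral>\<^sup>+y. ennreal ((F x - F y)\<^sup>2) \<partial>M) = ennreal (\<integral>y. (F x - F y)\<^sup>2 \<partial>M)"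
      by (intro nn_integral_eq_integral AE_I2 id) auto
    also have "(\<integral>y. (F x - F y)\<^sup>2 \<partial>M) = (F x)\<^sup>2 - 2 * F x * ?m + ?s"
      unfolding sq using i1 i2 by (simp add: prob_space)
    finally show ?thesis .
  qed
  have nn: "0 \<le> (F x)\<^sup>2 - 2 * F x * ?m + ?s" for x
  proof -
    have "(\<integral>y. (F x - F y)\<^sup>2 \<partial>M) = (F x)\<^sup>2 - 2 * F x * ?m + ?s"
      unfolding sq using i1 i2 by (simp add: prob_space)
    moreover have "0 \<le> (\<integral>y. (F x - F y)\<^sup>2 \<partial>M)" by simp
    ultimately show ?thesis by simp
  qed
  have "(\<integral>\<^sup>+x. \<integral>\<^sup>+y. ennreal ((F x - F y)\<^sup>2) \<partial>M \<partial>M) = ennreal (\<integral>x. (F x)\<^sup>2 - 2 * F x * ?m + ?s \<partial>M)"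
    unfolding in1 using i1 i2 nn by (intro nn_integral_eq_integral AE_I2) auto
  also have "(\<integral>x. (F x)\<^sup>2 - 2 * F x * ?m + ?s \<partial>M) = 2 * (?s - ?m\<^sup>2)"
    using i1 i2 by (simp add: prob_space power2_eq_square)
  finally show ?thesis by simp
qed

text \<open>Sharp one-dimensional Poincare inequality. For a smooth \<open>F\<close> the hypothesis holds with
  \<open>H = F'\<^sup>2\<close> by Cauchy--Schwarz; this weaker form is stable under averaging \<open>F\<close> and \<open>H\<close> over further
  variables and under truncation of \<open>F\<close>.\<close>

lemma std_normal_poincare:
  fixes F :: "real \<Rightarrow> real" and H :: "real \<Rightarrow> ennreal"
  assumes F[measurable]: "F \<in> borel_measurable borel" and bd: "\<And>x. \<bar>F x\<bar> \<le> B"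
    and [measurable]: "H \<in> borel_measurable borel"
    and FH: "\<And>s t. s \<le> t \<Longrightarrow> ennreal ((F t - F s)\<^sup>2) \<le> ennreal (t - s) * (\<integral>\<^sup>+u. H u * indicator {s..<t} u \<partial>lborel)"
  shows "ennreal ((\<integral>x. (F x)\<^sup>2 \<partial>std_normal) - (\<integral>x. F x \<partial>std_normal)\<^sup>2) \<le> (\<integral>\<^sup>+x. H x \<partial>std_normal)"
proof -
  interpret N: prob_space std_normal by (rule prob_space_std_normal)
  interpret NL: pair_sigma_finite std_normal lborel ..
  interpret NN: pair_sigma_finite std_normal std_normal ..
  \<comment> \<open>This is the right-hand side of \<open>FH\<close> with the interval indicator
    split into a condition on \<open>x\<close> and one on \<open>y\<close>, ready for
    \<open>std_normal_kernel\<close>. It vanishes for \<open>y \<le> x\<close>.\<close>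
  define L where "L x y = (\<integral>\<^sup>+u. ennreal (y - x) * (H u * (indicator {..u} x * indicator {u<..} y)) \<partial>lborel)" for x y
  have [measurable]: "(\<lambda>(x, y). L x y) \<in> borel_measurable (std_normal \<Otimes>\<^sub>M std_normal)"
    unfolding L_def indicator_def atMost_iff greaterThan_iff by measurable
  have FL: "ennreal ((F y - F x)\<^sup>2) \<le> L x y" if "x \<le> y" for x y
  proof -
    have "ennreal (y - x) * (\<integral>\<^sup>+u. H u * indicator {x..<y} u \<partial>lborel)
        = (\<integral>\<^sup>+u. ennreal (y - x) * (H u * indicator {x..<y} u) \<partial>lborel)"
      by (simp add: nn_integral_cmult)
    also have "\<dots> = L x y"
      unfolding L_def by (intro nn_integral_cong) (auto simp: indicator_def)
    finally show ?thesis using FH[OF that] by simp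
  qed
  \<comment> \<open>For either order of the arguments one summand already dominates; the symmetric
    form accounts for the factor 2 in \<open>variance_doubling\<close>.\<close>
  have D: "ennreal ((F x - F y)\<^sup>2) \<le> L x y + L y x" for x y
    using FL[of x y] FL[of y x] add_increasing2[of "L y x"] add_increasing[of "L x y"]
    by (cases "x \<le> y") (auto simp: power2_commute[of "F x" "F y"])
  have LH: "(\<integral>\<^sup>+x. \<integral>\<^sup>+y. L x y \<partial>std_normal \<partial>std_normal) = (\<integral>\<^sup>+x. H x \<partial>std_normal)"
  proof -
    have "(\<integral>\<^sup>+x. \<integral>\<^sup>+y. L x y \<partial>std_normal \<partial>std_normal)
        = (\<integral>\<^sup>+x. \<integral>\<^sup>+u. \<integral>\<^sup>+y. ennreal (y - x) * (H u * (indicator {..u} x * indicator {u<..} y)) \<partial>std_normal \<partial>lborel \<partial>std_normal)"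
      unfolding L_def indicator_def atMost_iff greaterThan_iff by (rule nn_integral_cong, rule NL.Fubini'[symmetric]) measurable
    also have "\<dots> = (\<integral>\<^sup>+u. \<integral>\<^sup>+x. \<integral>\<^sup>+y. ennreal (y - x) * (H u * (indicator {..u} x * indicator {u<..} y)) \<partial>std_normal \<partial>std_normal \<partial>lborel)"
      unfolding indicator_def atMost_iff greaterThan_iff by (rule NL.Fubini'[symmetric]) measurable
    also have "\<dots> = (\<integral>\<^sup>+u. H u * (\<integral>\<^sup>+x. \<integral>\<^sup>+y. ennreal (y - x) * (indicator {..u} x * indicator {u<..} y) \<partial>std_normal \<partial>std_normal) \<partial>lborel)"
    proof (rule nn_integral_cong)
      fix u
      have "(\<integral>\<^sup>+x. \<integral>\<^sup>+y. H u * (ennreal (y - x) * (indicator {..u} x * indicator {u<..} y)) \<partial>std_normal \<partial>std_normal)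
          = H u * (\<integral>\<^sup>+x. \<integral>\<^sup>+y. ennreal (y - x) * (indicator {..u} x * indicator {u<..} y) \<partial>std_normal \<partial>std_normal)"
        by (subst nn_integral_cmult, measurable)+
      then show "(\<integral>\<^sup>+x. \<integral>\<^sup>+y. ennreal (y - x) * (H u * (indicator {..u} x * indicator {u<..} y)) \<partial>std_normal \<partial>std_normal)
          = H u * (\<integral>\<^sup>+x. \<integral>\<^sup>+y. ennreal (y - x) * (indicator {..u} x * indicator {u<..} y) \<partial>std_normal \<partial>std_normal)"
        by (simp add: mult_ac)
    qed
    also have "\<dots> = (\<integral>\<^sup>+x. H x \<partial>std_normal)"
      unfolding std_normal_kernel by (simp add: nn_integral_std_normal mult.commute)
    finally show ?thesis .
  qed
  have "ennreal (2 * ((\<integral>x. (F x)\<^sup>2 \<partial>std_normal) - (\<integral>x. F x \<partial>std_normal)\<^sup>2))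
      = (\<integral>\<^sup>+x. \<integral>\<^sup>+y. ennreal ((F x - F y)\<^sup>2) \<partial>std_normal \<partial>std_normal)"
    by (rule N.variance_doubling[where B=B]) (use bd in auto)
  also have "\<dots> \<le> (\<integral>\<^sup>+x. \<integral>\<^sup>+y. L x y + L y x \<partial>std_normal \<partial>std_normal)"
    by (intro nn_integral_mono D)
  also have "\<dots> = (\<integral>\<^sup>+x. \<integral>\<^sup>+y. L x y \<partial>std_normal \<partial>std_normal) + (\<integral>\<^sup>+x. \<integral>\<^sup>+y. L y x \<partial>std_normal \<partial>std_normal)"
    by (simp add: nn_integral_add)
  also have "(\<integral>\<^sup>+x. \<integral>\<^sup>+y. L y x \<partial>std_normal \<partial>std_normal) = (\<integral>\<^sup>+x. \<integral>\<^sup>+y. L x y \<partial>std_normal \<partial>std_normal)"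
    by (rule NN.Fubini') measurable
  finally have "ennreal (2 * ((\<integral>x. (F x)\<^sup>2 \<partial>std_normal) - (\<integral>x. F x \<partial>std_normal)\<^sup>2)) \<le> ennreal 2 * (\<integral>\<^sup>+x. H x \<partial>std_normal)"
    unfolding LH by (simp add: mult_2[symmetric])
  then have "ennreal 2 * ennreal ((\<integral>x. (F x)\<^sup>2 \<partial>std_normal) - (\<integral>x. F x \<partial>std_normal)\<^sup>2) \<le> ennreal 2 * (\<integral>\<^sup>+x. H x \<partial>std_normal)"
    by (subst (asm) ennreal_mult') auto
  then show ?thesis
    by (subst (asm) ennreal_mult_le_mult_iff) auto
qed

section \<open>The Poincare inequality for product measures\<close>

abbreviation std_normals :: "'i set \<Rightarrow> ('i \<Rightarrow> real) measure" where
  "std_normals I \<equiv> PiM I (\<lambda>_. std_normal)"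

lemma (in prob_space) expectation_squared_le:
  fixes X :: "'a \<Rightarrow> real"
  assumes "integrable M X" "integrable M (\<lambda>x. (X x)\<^sup>2)"
  shows "(expectation X)\<^sup>2 \<le> expectation (\<lambda>x. (X x)\<^sup>2)"
  using variance_eq[OF assms] variance_positive[of X] by simp

text \<open>Law of total variance, conditioning on the new coordinate \<open>j\<close>. The
  induction hypothesis bounds the conditional variance for each fixed value, and
  \<open>std_normal_poincare\<close> bounds the variance of the conditional mean \<open>F\<close>.
  \<open>G i\<close> plays the role of the squared partial derivative.\<close>

lemma std_normals_poincare:
  fixes f :: "('i \<Rightarrow> real) \<Rightarrow> real" and G :: "'i \<Rightarrow> ('i \<Rightarrow> real) \<Rightarrow> ennreal"
  assumes "finite I"
    and "f \<in> borel_measurable (std_normals I)"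
    and "\<And>x. x \<in> space (std_normals I) \<Longrightarrow> \<bar>f x\<bar> \<le> B"
    and "\<And>i. i \<in> I \<Longrightarrow> G i \<in> borel_measurable (std_normals I)"
    and "\<And>i x s t. i \<in> I \<Longrightarrow> x \<in> space (std_normals I) \<Longrightarrow> s \<le> t \<Longrightarrow>
      ennreal ((f (x(i := t)) - f (x(i := s)))\<^sup>2) \<le> ennreal (t - s) * (\<integral>\<^sup>+u. G i (x(i := u)) * indicator {s..<t} u \<partial>lborel)"
  shows "ennreal ((\<integral>x. (f x)\<^sup>2 \<partial>std_normals I) - (\<integral>x. f x \<partial>std_normals I)\<^sup>2)
    \<le> (\<Sum>i\<in>I. \<integral>\<^sup>+x. G i x \<partial>std_normals I)"
  using assms
proof (induction I arbitrary: f G rule: finite_induct)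
  case empty
  then show ?case by (simp add: PiM_empty lebesgue_integral_count_space_finite)
next
  case (insert j J)
  note f[measurable] = insert.prems(1) and bd = insert.prems(2) and G = insert.prems(3) and inc = insert.prems(4)
  interpret N: prob_space std_normal by (rule prob_space_std_normal)
  interpret prod: product_prob_space "\<lambda>_::'i. std_normal" ..
  let ?I = "insert j J"
  interpret J: prob_space "std_normals J" by (rule prob_space_PiM) (rule prob_space_std_normal)
  interpret I: prob_space "std_normals ?I" by (rule prob_space_PiM) (rule prob_space_std_normal)
  interpret P: pair_prob_space "std_normals J" std_normal ..
  have upd: "x(j := t) \<in> space (std_normals ?I)" if "x \<in> space (std_normals J)" for x t
    using that by (auto simp: space_PiM PiE_def extensional_def)
  have upd': "x(i := t) \<in> space (std_normals J)" if "x \<in> space (std_normals J)" "i \<in> J" for x i t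
    using that by (auto simp: space_PiM PiE_def extensional_def)
  have [measurable]: "(\<lambda>(x, t). x(j := t)) \<in> std_normals J \<Otimes>\<^sub>M std_normal \<rightarrow>\<^sub>M std_normals ?I"
    by (rule measurable_add_dim)
  have [measurable]: "(\<lambda>x. x(j := t)) \<in> std_normals J \<rightarrow>\<^sub>M std_normals ?I" for t
  proof -
    have "(\<lambda>x. (x, t)) \<in> std_normals J \<rightarrow>\<^sub>M std_normals J \<Otimes>\<^sub>M std_normal" by measurable
    from measurable_compose[OF this measurable_add_dim] show ?thesis by simp
  qed
  have split: "(\<integral>x. h x \<partial>std_normals ?I) = (\<integral>t. \<integral>x. h (x(j := t)) \<partial>std_normals J \<partial>std_normal)"
    if [measurable]: "h \<in> borel_measurable (std_normals ?I)"
      and hb: "\<And>x. x \<in> space (std_normals ?I) \<Longrightarrow> \<bar>h x\<bar> \<le> C" for h :: "('i \<Rightarrow> real) \<Rightarrow> real" and C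
  proof -
    have "integrable (std_normals ?I) h" by (rule I.integrable_const_bound[where B=C]) (use hb in auto)
    then have "(\<integral>x. h x \<partial>std_normals ?I) = (\<integral>x. \<integral>t. h (x(j := t)) \<partial>std_normal \<partial>std_normals J)"
      using insert.hyps by (intro prod.product_integral_insert)
    also have "\<dots> = (\<integral>t. \<integral>x. h (x(j := t)) \<partial>std_normals J \<partial>std_normal)"
    proof (rule P.Fubini_integral[symmetric])
      show "integrable (std_normals J \<Otimes>\<^sub>M std_normal) (\<lambda>(x, t). h (x(j := t)))"
        by (rule P.integrable_const_bound[where B=C]) (use hb upd in \<open>auto simp: space_pair_measure\<close>)
    qed
    finally show ?thesis .
  qed
  have sqb: "\<bar>(f x)\<^sup>2\<bar> \<le> B\<^sup>2" if "x \<in> space (std_normals ?I)" for x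
    using power_mono[OF bd[OF that], of 2] by simp
  have if1: "integrable (std_normals J) (\<lambda>x. f (x(j := t)))" for t
    by (rule J.integrable_const_bound[where B=B]) (use bd upd in auto)
  have if2: "integrable (std_normals J) (\<lambda>x. (f (x(j := t)))\<^sup>2)" for t
    by (rule J.integrable_const_bound[where B="B\<^sup>2"]) (use sqb upd in auto)
  have ifd: "integrable (std_normals J) (\<lambda>x. (f (x(j := t)) - f (x(j := s)))\<^sup>2)" for s t
  proof (rule J.integrable_const_bound[where B="(2 * B)\<^sup>2"])
    have "\<bar>f (x(j := t)) - f (x(j := s))\<bar> \<le> 2 * B" if "x \<in> space (std_normals J)" for x
      using bd[OF upd[OF that], of t] bd[OF upd[OF that], of s] by linarith
    then have "\<bar>f (x(j := t)) - f (x(j := s))\<bar>\<^sup>2 \<le> (2 * B)\<^sup>2" if "x \<in> space (std_normals J)" for x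
      using that by (intro power_mono) auto
    then show "AE x in std_normals J. norm ((f (x(j := t)) - f (x(j := s)))\<^sup>2) \<le> (2 * B)\<^sup>2"
      by (intro AE_I2) auto
  qed measurable
  define F where "F t = (\<integral>x. f (x(j := t)) \<partial>std_normals J)" for t
  define S where "S t = (\<integral>x. (f (x(j := t)))\<^sup>2 \<partial>std_normals J)" for t
  have [measurable]: "F \<in> borel_measurable std_normal" "S \<in> borel_measurable std_normal"
    unfolding F_def S_def by measurable
  have Fb: "\<bar>F t\<bar> \<le> B" for t
  proof -
    have "\<bar>F t\<bar> \<le> (\<integral>x. \<bar>f (x(j := t))\<bar> \<partial>std_normals J)"
      unfolding F_def using integral_norm_bound[of "std_normals J" "\<lambda>x. f (x(j := t))"] by simp
    also have "\<dots> \<le> (\<integral>x. B \<partial>std_normals J)"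
      by (intro integral_mono_AE integrable_abs if1 AE_I2) (use bd upd in auto)
    finally show ?thesis by (simp add: J.prob_space)
  qed
  have FS: "(F t)\<^sup>2 \<le> S t" for t
    unfolding F_def S_def by (intro J.expectation_squared_le if1 if2)
  have Sb: "\<bar>S t\<bar> \<le> B\<^sup>2" for t
  proof -
    have "\<bar>S t\<bar> = S t" using FS[of t] zero_le_power2[of "F t"] by linarith
    also have "S t \<le> (\<integral>x. B\<^sup>2 \<partial>std_normals J)"
      unfolding S_def by (intro integral_mono_AE if2 AE_I2) (use sqb upd in auto)
    finally show ?thesis by (simp add: J.prob_space)
  qed
  have intS: "integrable std_normal S" by (rule N.integrable_const_bound[where B="B\<^sup>2"]) (use Sb in auto)
  have "(F t)\<^sup>2 \<le> B\<^sup>2" for t using power_mono[OF Fb[of t], of 2] by simp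
  then have intF2: "integrable std_normal (\<lambda>t. (F t)\<^sup>2)"
    by (intro N.integrable_const_bound[where B="B\<^sup>2"]) auto
  have inner: "ennreal (S t - (F t)\<^sup>2) \<le> (\<Sum>i\<in>J. \<integral>\<^sup>+x. G i (x(j := t)) \<partial>std_normals J)" for t
    unfolding S_def F_def
  proof (rule insert.IH)
    show "(\<lambda>x. f (x(j := t))) \<in> borel_measurable (std_normals J)" by measurable
    show "\<bar>f (x(j := t))\<bar> \<le> B" if "x \<in> space (std_normals J)" for x using bd upd[OF that] by blast
    show "(\<lambda>x. G i (x(j := t))) \<in> borel_measurable (std_normals J)" if "i \<in> J" for i
    proof -
      have [measurable]: "G i \<in> borel_measurable (std_normals ?I)" using G that by blast
      show ?thesis by measurable
    qed
    show "ennreal ((f ((x(i := r))(j := t)) - f ((x(i := s))(j := t)))\<^sup>2)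
        \<le> ennreal (r - s) * (\<integral>\<^sup>+u. G i ((x(i := u))(j := t)) * indicator {s..<r} u \<partial>lborel)"
      if "i \<in> J" "x \<in> space (std_normals J)" "s \<le> r" for i x s r
    proof -
      have "i \<noteq> j" using that insert.hyps by auto
      then have tw: "(x(i := u))(j := t) = (x(j := t))(i := u)" for u by (rule fun_upd_twist)
      show ?thesis unfolding tw using inc[of i "x(j := t)" s r] that upd by blast
    qed
  qed
  have outer: "ennreal ((\<integral>t. (F t)\<^sup>2 \<partial>std_normal) - (\<integral>t. F t \<partial>std_normal)\<^sup>2) \<le> (\<integral>\<^sup>+x. G j x \<partial>std_normals ?I)"
  proof -
    have [measurable]: "G j \<in> borel_measurable (std_normals ?I)" using G by blast
    interpret PL: pair_sigma_finite "std_normals J" lborel ..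
    have [measurable]: "(\<lambda>(x, t). x(j := t)) \<in> std_normals J \<Otimes>\<^sub>M lborel \<rightarrow>\<^sub>M std_normals ?I"
      using measurable_add_dim[of j J "\<lambda>_. std_normal"] by (simp cong: measurable_cong_sets)
    \<comment> \<open>By Jensen, averaging over the other coordinates carries the increment bound
      for \<open>f\<close> along \<open>j\<close> to the conditional mean, with the averaged
      \<open>G j\<close> in the bound.\<close>
    define H where "H u = (\<integral>\<^sup>+x. G j (x(j := u)) \<partial>std_normals J)" for u
    have [measurable]: "H \<in> borel_measurable borel"
      unfolding H_def using J.borel_measurable_nn_integral_fst by measurable
    have "ennreal ((\<integral>t. (F t)\<^sup>2 \<partial>std_normal) - (\<integral>t. F t \<partial>std_normal)\<^sup>2) \<le> (\<integral>\<^sup>+u. H u \<partial>std_normal)"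
    proof (rule std_normal_poincare[where B=B])
      show "ennreal ((F t - F s)\<^sup>2) \<le> ennreal (t - s) * (\<integral>\<^sup>+u. H u * indicator {s..<t} u \<partial>lborel)" if st: "s \<le> t" for s t
      proof -
        have "(F t - F s)\<^sup>2 = (\<integral>x. f (x(j := t)) - f (x(j := s)) \<partial>std_normals J)\<^sup>2"
          unfolding F_def using if1 by simp
        also have "\<dots> \<le> (\<integral>x. (f (x(j := t)) - f (x(j := s)))\<^sup>2 \<partial>std_normals J)"
          by (intro J.expectation_squared_le ifd Bochner_Integration.integrable_diff if1)
        finally have "ennreal ((F t - F s)\<^sup>2) \<le> ennreal (\<integral>x. (f (x(j := t)) - f (x(j := s)))\<^sup>2 \<partial>std_normals J)"
          by (rule ennreal_leI)
        also have "\<dots> = (\<integral>\<^sup>+x. ennreal ((f (x(j := t)) - f (x(j := s)))\<^sup>2) \<partial>std_normals J)"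
          by (intro nn_integral_eq_integral[symmetric] ifd) auto
        also have "\<dots> \<le> (\<integral>\<^sup>+x. ennreal (t - s) * (\<integral>\<^sup>+u. G j (x(j := u)) * indicator {s..<t} u \<partial>lborel) \<partial>std_normals J)"
        proof (rule nn_integral_mono)
          fix x assume x: "x \<in> space (std_normals J)"
          show "ennreal ((f (x(j := t)) - f (x(j := s)))\<^sup>2)
              \<le> ennreal (t - s) * (\<integral>\<^sup>+u. G j (x(j := u)) * indicator {s..<t} u \<partial>lborel)"
            \<comment> \<open>The value 0 is a placeholder: coordinate \<open>j\<close> is
              overwritten in every term.\<close>
            using inc[OF insertI1 upd[OF x, of 0] st] by (simp only: fun_upd_upd)
        qed
        also have "\<dots> = ennreal (t - s) * (\<integral>\<^sup>+x. \<integral>\<^sup>+u. G j (x(j := u)) * indicator {s..<t} u \<partial>lborel \<partial>std_normals J)"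
          by (rule nn_integral_cmult) measurable
        also have "(\<integral>\<^sup>+x. \<integral>\<^sup>+u. G j (x(j := u)) * indicator {s..<t} u \<partial>lborel \<partial>std_normals J)
            = (\<integral>\<^sup>+u. \<integral>\<^sup>+x. G j (x(j := u)) * indicator {s..<t} u \<partial>std_normals J \<partial>lborel)"
          by (rule PL.Fubini'[symmetric]) measurable
        also have "\<dots> = (\<integral>\<^sup>+u. H u * indicator {s..<t} u \<partial>lborel)"
          unfolding H_def by (intro nn_integral_cong nn_integral_multc) measurable
        finally show ?thesis .
      qed
    qed (use Fb in auto)
    also have "(\<integral>\<^sup>+u. H u \<partial>std_normal) = (\<integral>\<^sup>+x. G j x \<partial>std_normals ?I)"
      unfolding H_def using insert.hyps by (intro prod.product_nn_integral_insert_rev[symmetric]) auto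
    finally show ?thesis .
  qed
  have F1: "(\<integral>x. f x \<partial>std_normals ?I) = (\<integral>t. F t \<partial>std_normal)"
    unfolding F_def by (rule split[OF f bd])
  have F2: "(\<integral>x. (f x)\<^sup>2 \<partial>std_normals ?I) = (\<integral>t. S t \<partial>std_normal)"
    unfolding S_def by (rule split[OF _ sqb]) measurable
  have "(\<integral>x. (f x)\<^sup>2 \<partial>std_normals ?I) - (\<integral>x. f x \<partial>std_normals ?I)\<^sup>2
      = (\<integral>t. S t - (F t)\<^sup>2 \<partial>std_normal) + ((\<integral>t. (F t)\<^sup>2 \<partial>std_normal) - (\<integral>t. F t \<partial>std_normal)\<^sup>2)"
    unfolding F1 F2 using intS intF2 by simp
  then have "ennreal ((\<integral>x. (f x)\<^sup>2 \<partial>std_normals ?I) - (\<integral>x. f x \<partial>std_normals ?I)\<^sup>2)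
      \<le> ennreal (\<integral>t. S t - (F t)\<^sup>2 \<partial>std_normal) + ennreal ((\<integral>t. (F t)\<^sup>2 \<partial>std_normal) - (\<integral>t. F t \<partial>std_normal)\<^sup>2)"
    using FS by (simp add: ennreal_plus_if integral_nonneg_AE)
  also have "ennreal (\<integral>t. S t - (F t)\<^sup>2 \<partial>std_normal) \<le> (\<Sum>i\<in>J. \<integral>\<^sup>+x. G i x \<partial>std_normals ?I)"
  proof -
    have "ennreal (\<integral>t. S t - (F t)\<^sup>2 \<partial>std_normal) = (\<integral>\<^sup>+t. ennreal (S t - (F t)\<^sup>2) \<partial>std_normal)"
      using intS intF2 FS by (intro nn_integral_eq_integral[symmetric]) auto
    also have "\<dots> \<le> (\<integral>\<^sup>+t. (\<Sum>i\<in>J. \<integral>\<^sup>+x. G i (x(j := t)) \<partial>std_normals J) \<partial>std_normal)"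
      by (intro nn_integral_mono inner)
    also have "\<dots> = (\<Sum>i\<in>J. \<integral>\<^sup>+t. \<integral>\<^sup>+x. G i (x(j := t)) \<partial>std_normals J \<partial>std_normal)"
    proof (rule nn_integral_sum)
      fix i assume "i \<in> J"
      then have [measurable]: "G i \<in> borel_measurable (std_normals ?I)" using G by blast
      show "(\<lambda>t. \<integral>\<^sup>+x. G i (x(j := t)) \<partial>std_normals J) \<in> borel_measurable std_normal" by measurable
    qed
    also have "\<dots> = (\<Sum>i\<in>J. \<integral>\<^sup>+x. G i x \<partial>std_normals ?I)"
      using insert.hyps G by (intro sum.cong refl prod.product_nn_integral_insert_rev[symmetric]) auto
    finally show ?thesis .
  qed
  finally show ?case
    using outer insert.hyps by (simp add: add.commute add_mono order_trans)
qed

lemma std_normals_density: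
  assumes "finite I"
  shows "std_normals I = density (PiM I (\<lambda>_. lborel)) (\<lambda>x. \<Prod>i\<in>I. ennreal (std_normal_density (x i)))"
proof -
  interpret N: prob_space std_normal by (rule prob_space_std_normal)
  interpret prod: product_sigma_finite "\<lambda>_. std_normal" by standard
  interpret L: product_sigma_finite "\<lambda>_. lborel :: real measure" by standard
  have "density (PiM I (\<lambda>_. lborel)) (\<lambda>x. \<Prod>i\<in>I. ennreal (std_normal_density (x i))) = std_normals I"
  proof (rule prod.PiM_eqI[OF assms])
    show "sets (density (PiM I (\<lambda>_. lborel)) (\<lambda>x. \<Prod>i\<in>I. ennreal (std_normal_density (x i)))) = sets (std_normals I)"
      by (simp cong: sets_PiM_cong)
    fix A assume A: "\<And>i. i \<in> I \<Longrightarrow> A i \<in> sets std_normal"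
    then have [measurable]: "Pi\<^sub>E I A \<in> sets (PiM I (\<lambda>_. lborel))"
      using assms by (intro sets_PiM_I_finite) auto
    have "emeasure (density (PiM I (\<lambda>_. lborel)) (\<lambda>x. \<Prod>i\<in>I. ennreal (std_normal_density (x i)))) (Pi\<^sub>E I A)
        = (\<integral>\<^sup>+x. (\<Prod>i\<in>I. ennreal (std_normal_density (x i))) * indicator (Pi\<^sub>E I A) x \<partial>PiM I (\<lambda>_. lborel))"
      by (rule emeasure_density) measurable
    also have "\<dots> = (\<integral>\<^sup>+x. (\<Prod>i\<in>I. ennreal (std_normal_density (x i)) * indicator (A i) (x i)) \<partial>PiM I (\<lambda>_. lborel))"
    proof (rule nn_integral_cong)
      fix x assume "x \<in> space (PiM I (\<lambda>_. lborel :: real measure))"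
      then have "indicator (Pi\<^sub>E I A) x = (\<Prod>i\<in>I. indicator (A i) (x i) :: ennreal)"
        using assms by (auto simp: indicator_def space_PiM PiE_def prod.If_cases Pi_iff intro!: prod.neutral[symmetric] prod_zero[symmetric])
      then show "(\<Prod>i\<in>I. ennreal (std_normal_density (x i))) * indicator (Pi\<^sub>E I A) x
          = (\<Prod>i\<in>I. ennreal (std_normal_density (x i)) * indicator (A i) (x i))"
        by (simp add: prod.distrib)
    qed
    also have "\<dots> = (\<Prod>i\<in>I. \<integral>\<^sup>+x. ennreal (std_normal_density x) * indicator (A i) x \<partial>lborel)"
      using A by (intro L.product_nn_integral_prod assms) auto
    also have "\<dots> = (\<Prod>i\<in>I. emeasure std_normal (A i))"
      using A by (intro prod.cong refl) (simp add: std_normal_def emeasure_density)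
    finally show "emeasure (density (PiM I (\<lambda>_. lborel)) (\<lambda>x. \<Prod>i\<in>I. ennreal (std_normal_density (x i)))) (Pi\<^sub>E I A)
        = (\<Prod>i\<in>I. emeasure std_normal (A i))" .
  qed
  then show ?thesis by simp
qed

text \<open>Lebesgue measure is the image of the product measure under the coordinate map, so only
  the densities have to be matched. This carries the product inequality over to Euclidean
  space.\<close>

lemma std_gaussian_eq_distr:
  "(std_gaussian :: 'a::euclidean_space measure)
    = distr (std_normals Basis) borel (\<lambda>x. \<Sum>b\<in>Basis. x b *\<^sub>R b)"
proof (rule measure_eqI)
  let ?T = "\<lambda>x. \<Sum>b\<in>Basis. x b *\<^sub>R b :: 'a"
  fix A :: "'a set" assume "A \<in> sets std_gaussian"
  then have [measurable]: "A \<in> sets borel" by simp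
  have T[measurable]: "?T \<in> PiM Basis (\<lambda>_. lborel) \<rightarrow>\<^sub>M borel" "?T \<in> std_normals Basis \<rightarrow>\<^sub>M borel" by measurable
  have "emeasure std_gaussian A = (\<integral>\<^sup>+x. ennreal (gauss_density x) * indicator A x \<partial>lborel)"
    by (subst nn_integral_std_gaussian[symmetric]) auto
  also have "\<dots> = (\<integral>\<^sup>+x. ennreal (gauss_density (?T x)) * indicator A (?T x) \<partial>PiM Basis (\<lambda>_. lborel))"
    by (subst lborel_eq) (simp add: nn_integral_distr)
  also have "\<dots> = (\<integral>\<^sup>+x. (\<Prod>b\<in>(Basis::'a set). ennreal (std_normal_density (x b))) * indicator A (?T x) \<partial>PiM Basis (\<lambda>_. lborel))"
    by (intro nn_integral_cong) (simp add: gauss_density_def prod_ennreal)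
  also have "\<dots> = (\<integral>\<^sup>+x. indicator A (?T x) \<partial>std_normals Basis)"
    by (subst std_normals_density) (auto simp: nn_integral_density)
  also have "\<dots> = emeasure (distr (std_normals Basis) borel ?T) A"
    by (simp add: nn_integral_distr[OF T(2), of "indicator A", symmetric])
  finally show "emeasure std_gaussian A = emeasure (distr (std_normals Basis) borel ?T) A" .
qed simp

lemma std_gaussian_poincare:
  fixes f :: "'a::euclidean_space \<Rightarrow> real" and G :: "'a \<Rightarrow> 'a \<Rightarrow> ennreal"
  assumes [measurable]: "f \<in> borel_measurable borel" and bd: "\<And>x. \<bar>f x\<bar> \<le> B"
    and G: "\<And>b. b \<in> Basis \<Longrightarrow> G b \<in> borel_measurable borel"
    and inc: "\<And>b x s t. b \<in> Basis \<Longrightarrow> s \<le> t \<Longrightarrow>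
      ennreal ((f (x + t *\<^sub>R b) - f (x + s *\<^sub>R b))\<^sup>2) \<le> ennreal (t - s) * (\<integral>\<^sup>+u. G b (x + u *\<^sub>R b) * indicator {s..<t} u \<partial>lborel)"
  shows "ennreal ((\<integral>x. (f x)\<^sup>2 \<partial>std_gaussian) - (\<integral>x. f x \<partial>std_gaussian)\<^sup>2)
    \<le> (\<Sum>b\<in>Basis. \<integral>\<^sup>+x. G b x \<partial>std_gaussian)"
proof -
  let ?T = "\<lambda>x. \<Sum>b\<in>Basis. x b *\<^sub>R b :: 'a"
  have [measurable]: "?T \<in> std_normals Basis \<rightarrow>\<^sub>M borel" by measurable
  have upd: "?T (x(b := t)) = ?T (x(b := 0)) + t *\<^sub>R b" if "b \<in> Basis" for x b t
    using that by (simp add: sum.remove[of Basis b])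
  have "ennreal ((\<integral>x. (f (?T x))\<^sup>2 \<partial>std_normals Basis) - (\<integral>x. f (?T x) \<partial>std_normals Basis)\<^sup>2)
    \<le> (\<Sum>b\<in>Basis. \<integral>\<^sup>+x. G b (?T x) \<partial>std_normals Basis)"
  proof (rule std_normals_poincare[where B=B])
    show "(\<lambda>x. G b (?T x)) \<in> borel_measurable (std_normals Basis)" if "b \<in> Basis" for b
    proof -
      have [measurable]: "G b \<in> borel_measurable borel" using G that .
      show ?thesis by measurable
    qed
    show "ennreal ((f (?T (x(b := t))) - f (?T (x(b := s))))\<^sup>2)
        \<le> ennreal (t - s) * (\<integral>\<^sup>+u. G b (?T (x(b := u))) * indicator {s..<t} u \<partial>lborel)"
      if "b \<in> Basis" "s \<le> t" for b x s t
    proof -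
      define z where "z = ?T (x(b := 0))"
      have "?T (x(b := u)) = z + u *\<^sub>R b" for u
        unfolding z_def by (rule upd[OF that(1)])
      then show ?thesis using inc[OF that, of z] by simp
    qed
  qed (use bd in auto)
  then show ?thesis
    using G unfolding std_gaussian_eq_distr by (simp add: integral_distr nn_integral_distr)
qed

text \<open>Cauchy-Schwarz, obtained by integrating the nonnegative function
  \<open>(g' u - m)\<^sup>2\<close> with \<open>m\<close> the mean slope.\<close>

lemma square_increment_le_integral:
  fixes g g' :: "real \<Rightarrow> real"
  assumes st: "s \<le> t" and der: "\<And>u. (g has_real_derivative g' u) (at u)" and cont: "continuous_on UNIV g'"
  shows "ennreal ((g t - g s)\<^sup>2) \<le> ennreal (t - s) * (\<integral>\<^sup>+u. ennreal ((g' u)\<^sup>2) * indicator {s..<t} u \<partial>lborel)"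
proof (cases "s = t")
  case False
  then have lt: "s < t" using st by simp
  have c: "continuous_on {s..t} g'" using cont continuous_on_subset by blast
  define J where "J = integral {s..t} (\<lambda>u. (g' u)\<^sup>2)"
  have J: "((\<lambda>u. (g' u)\<^sup>2) has_integral J) {s..t}"
    unfolding J_def by (intro integrable_integral integrable_continuous_interval continuous_intros c)
  have D: "(g' has_integral (g t - g s)) {s..t}"
    using st der by (intro fundamental_theorem_of_calculus)
      (auto simp: has_real_derivative_iff_has_vector_derivative[symmetric] intro: has_field_derivative_at_within)
  define m where "m = (g t - g s) / (t - s)"
  have "((\<lambda>u. (g' u)\<^sup>2 - 2 * m * g' u + m\<^sup>2) has_integral (J - 2 * m * (g t - g s) + (t - s) * m\<^sup>2)) {s..t}"
    using has_integral_const_real[of "m\<^sup>2" s t] st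
    by (intro has_integral_add has_integral_diff has_integral_mult_right J D) auto
  then have "0 \<le> J - 2 * m * (g t - g s) + (t - s) * m\<^sup>2"
  proof (rule has_integral_nonneg)
    show "0 \<le> (g' u)\<^sup>2 - 2 * m * g' u + m\<^sup>2" for u
      using zero_le_power2[of "g' u - m"] by (simp add: power2_diff mult_ac)
  qed
  moreover have "g t - g s = m * (t - s)" using lt by (simp add: m_def)
  ultimately have "m\<^sup>2 * (t - s) \<le> J" by (simp add: power2_eq_square algebra_simps)
  then have "(t - s) * (m\<^sup>2 * (t - s)) \<le> (t - s) * J" using lt by (intro mult_left_mono) auto
  then have "(g t - g s)\<^sup>2 \<le> (t - s) * J"
    using \<open>g t - g s = m * (t - s)\<close> by (simp add: power2_eq_square mult_ac)
  then have "ennreal ((g t - g s)\<^sup>2) \<le> ennreal (t - s) * ennreal J"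
    using st by (simp add: ennreal_mult'[symmetric] ennreal_leI)
  also have "ennreal J = (\<integral>\<^sup>+u. ennreal ((g' u)\<^sup>2) * indicator {s..t} u \<partial>lborel)"
    by (rule nn_integral_has_integral_lebesgue'[symmetric]) (use J in auto)
  also have "\<dots> = (\<integral>\<^sup>+u. ennreal ((g' u)\<^sup>2) * indicator {s..<t} u \<partial>lborel)"
    \<comment> \<open>The endpoint \<open>t\<close> is a null set; the half-open interval is the
      form that \<open>std_normal_kernel\<close> needs.\<close>
    using AE_lborel_singleton[of t] by (intro nn_integral_cong_AE) (auto simp: indicator_def)
  finally show ?thesis .
qed simp

section \<open>Log-sum-exp smoothing of a finite maximum\<close>

definition soft_max :: "real \<Rightarrow> 'a::real_inner set \<Rightarrow> 'a \<Rightarrow> real" where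
  "soft_max \<beta> K x = ln (\<Sum>y\<in>K. exp (\<beta> * (y \<bullet> x))) / \<beta>"

lemma soft_max_ge:
  assumes "finite K" "y \<in> K" "\<beta> > 0"
  shows "y \<bullet> x \<le> soft_max \<beta> K x"
proof -
  have "exp (\<beta> * (y \<bullet> x)) \<le> (\<Sum>y\<in>K. exp (\<beta> * (y \<bullet> x)))"
    using assms by (intro member_le_sum) auto
  then have "\<beta> * (y \<bullet> x) \<le> ln (\<Sum>y\<in>K. exp (\<beta> * (y \<bullet> x)))"
    by (metis exp_gt_zero ln_exp ln_mono order_less_le_trans)
  then show ?thesis using assms by (simp add: soft_max_def field_simps)
qed

lemma soft_max_le:
  assumes "finite K" "K \<noteq> {}" "\<beta> > 0" "\<And>y. y \<in> K \<Longrightarrow> y \<bullet> x \<le> h"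
  shows "soft_max \<beta> K x \<le> h + ln (real (card K)) / \<beta>"
proof -
  have c: "card K > 0" using assms by (simp add: card_gt_0_iff)
  have "(\<Sum>y\<in>K. exp (\<beta> * (y \<bullet> x))) \<le> (\<Sum>y\<in>K. exp (\<beta> * h))"
    using assms by (intro sum_mono) auto
  moreover have "0 < (\<Sum>y\<in>K. exp (\<beta> * (y \<bullet> x)))" using assms by (intro sum_pos) auto
  ultimately have "ln (\<Sum>y\<in>K. exp (\<beta> * (y \<bullet> x))) \<le> ln (real (card K) * exp (\<beta> * h))"
    by (intro ln_mono) auto
  also have "\<dots> = ln (real (card K)) + \<beta> * h" using c by (simp add: ln_mult)
  finally show ?thesis using assms(3) by (simp add: soft_max_def field_simps)
qed

text \<open>The truncation provides the boundedness required by
  \<open>std_gaussian_poincare\<close>. Being 1-Lipschitz, it does not enlarge increments, so the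
  untruncated gradient still bounds them.\<close>

lemma truncated_soft_max_variance:
  fixes K :: "'a::euclidean_space set"
  assumes K: "finite K" "K \<noteq> {}" "K \<subseteq> sphere 0 1" and \<beta>: "\<beta> > 0" and B: "B \<ge> 0"
  defines "f \<equiv> \<lambda>x. max (- B) (min B (soft_max \<beta> K x))"
  shows "(\<integral>x. (f x)\<^sup>2 \<partial>std_gaussian) - (\<integral>x. f x \<partial>std_gaussian)\<^sup>2 \<le> 1"
proof -
  interpret prob_space "std_gaussian :: 'a measure" by (rule prob_space_std_gaussian)
  define Z where "Z x = (\<Sum>y\<in>K. exp (\<beta> * (y \<bullet> x)))" for x
  have Z: "Z x > 0" for x unfolding Z_def using K by (intro sum_pos) auto
  have Z0: "Z x \<noteq> 0" for x using Z[of x] by simp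
  \<comment> \<open>The gradient of \<open>soft_max \<beta> K\<close>: a convex combination of the
    points of \<open>K\<close>, hence of norm at most 1.\<close>
  define D where "D x = (1 / Z x) *\<^sub>R (\<Sum>y\<in>K. exp (\<beta> * (y \<bullet> x)) *\<^sub>R y)" for x
  have contZ: "continuous_on UNIV Z" unfolding Z_def[abs_def] by (intro continuous_intros)
  have contD: "continuous_on UNIV D"
    unfolding D_def[abs_def] using Z0 by (intro continuous_intros contZ) auto
  have normD: "norm (D x) \<le> 1" for x
  proof -
    have "norm (\<Sum>y\<in>K. exp (\<beta> * (y \<bullet> x)) *\<^sub>R y) \<le> (\<Sum>y\<in>K. exp (\<beta> * (y \<bullet> x)))"
      by (rule order.trans[OF norm_sum]) (use K in \<open>auto intro!: sum_mono\<close>)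
    then show ?thesis using Z[of x] by (simp add: D_def Z_def[symmetric] field_simps)
  qed
  have [measurable]: "D \<in> borel_measurable borel" "Z \<in> borel_measurable borel"
    using contD contZ by (auto intro: borel_measurable_continuous_onI)
  have sm: "soft_max \<beta> K x = ln (Z x) / \<beta>" for x by (simp add: soft_max_def Z_def)
  have [measurable]: "f \<in> borel_measurable borel"
    unfolding f_def sm by measurable
  have "ennreal ((\<integral>x. (f x)\<^sup>2 \<partial>std_gaussian) - (\<integral>x. f x \<partial>std_gaussian)\<^sup>2)
      \<le> (\<Sum>b\<in>Basis. \<integral>\<^sup>+x. ennreal ((D x \<bullet> b)\<^sup>2) \<partial>std_gaussian)"
  proof (rule std_gaussian_poincare[where B=B])
    show "\<bar>f x\<bar> \<le> B" for x using B by (auto simp: f_def)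
    fix b x :: 'a and s t :: real assume b: "b \<in> Basis" and st: "s \<le> t"
    let ?g = "\<lambda>u. soft_max \<beta> K (x + u *\<^sub>R b)"
    have "\<bar>f (x + t *\<^sub>R b) - f (x + s *\<^sub>R b)\<bar> \<le> \<bar>?g t - ?g s\<bar>" by (auto simp: f_def)
    then have "(f (x + t *\<^sub>R b) - f (x + s *\<^sub>R b))\<^sup>2 \<le> (?g t - ?g s)\<^sup>2" by (rule abs_le_square_iff[THEN iffD1])
    then have "ennreal ((f (x + t *\<^sub>R b) - f (x + s *\<^sub>R b))\<^sup>2) \<le> ennreal ((?g t - ?g s)\<^sup>2)" by (rule ennreal_leI)
    also have "\<dots> \<le> ennreal (t - s) * (\<integral>\<^sup>+u. ennreal ((D (x + u *\<^sub>R b) \<bullet> b)\<^sup>2) * indicator {s..<t} u \<partial>lborel)"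
    proof (rule square_increment_le_integral[OF st])
      show "continuous_on UNIV (\<lambda>u. D (x + u *\<^sub>R b) \<bullet> b)"
        by (intro continuous_intros continuous_on_compose2[OF contD]) auto
      show "(?g has_real_derivative D (x + u *\<^sub>R b) \<bullet> b) (at u)" for u
      proof -
        have "((\<lambda>u. Z (x + u *\<^sub>R b)) has_real_derivative (\<Sum>y\<in>K. exp (\<beta> * (y \<bullet> (x + u *\<^sub>R b))) * (\<beta> * (y \<bullet> b)))) (at u)"
          unfolding Z_def by (auto intro!: derivative_eq_intros simp: inner_add_right mult_ac)
        then have "(?g has_real_derivative (\<Sum>y\<in>K. exp (\<beta> * (y \<bullet> (x + u *\<^sub>R b))) * (\<beta> * (y \<bullet> b))) / Z (x + u *\<^sub>R b) / \<beta>) (at u)"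
          unfolding sm using Z \<beta> by (auto intro!: derivative_eq_intros)
        also have "(\<Sum>y\<in>K. exp (\<beta> * (y \<bullet> (x + u *\<^sub>R b))) * (\<beta> * (y \<bullet> b))) / Z (x + u *\<^sub>R b) / \<beta> = D (x + u *\<^sub>R b) \<bullet> b"
        proof -
          have "(\<Sum>y\<in>K. exp (\<beta> * (y \<bullet> (x + u *\<^sub>R b))) * (\<beta> * (y \<bullet> b))) = \<beta> * (\<Sum>y\<in>K. exp (\<beta> * (y \<bullet> (x + u *\<^sub>R b))) * (y \<bullet> b))"
            by (simp add: sum_distrib_left mult_ac)
          then show ?thesis using \<beta> by (simp add: D_def inner_sum_left)
        qed
        finally show ?thesis .
      qed
    qed
    finally show "ennreal ((f (x + t *\<^sub>R b) - f (x + s *\<^sub>R b))\<^sup>2)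
        \<le> ennreal (t - s) * (\<integral>\<^sup>+u. ennreal ((D (x + u *\<^sub>R b) \<bullet> b)\<^sup>2) * indicator {s..<t} u \<partial>lborel)" .
  qed measurable
  also have "\<dots> = (\<integral>\<^sup>+x. (\<Sum>b\<in>Basis. ennreal ((D x \<bullet> b)\<^sup>2)) \<partial>std_gaussian)"
    by (rule nn_integral_sum[symmetric]) measurable
  also have "\<dots> \<le> (\<integral>\<^sup>+x. 1 \<partial>(std_gaussian :: 'a measure))"
  proof (rule nn_integral_mono)
    fix x
    have "(\<Sum>b\<in>Basis. (D x \<bullet> b)\<^sup>2) = (norm (D x))\<^sup>2"
      unfolding power2_norm_eq_inner by (subst euclidean_inner) (simp add: power2_eq_square)
    also have "\<dots> \<le> 1" using normD[of x] by (simp add: power_le_one)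
    finally show "(\<Sum>b\<in>Basis. ennreal ((D x \<bullet> b)\<^sup>2)) \<le> 1"
      by (subst sum_ennreal) auto
  qed
  also have "\<dots> = 1" by (simp add: emeasure_space_1[simplified])
  finally have "ennreal ((\<integral>x. (f x)\<^sup>2 \<partial>std_gaussian) - (\<integral>x. f x \<partial>std_gaussian)\<^sup>2) \<le> ennreal 1" by simp
  then show ?thesis by (subst (asm) ennreal_le_iff) auto
qed

subsection \<open>The variance of a support function\<close>

lemma ex_dense_sequence:
  fixes A :: "'a::euclidean_space set"
  assumes "A \<noteq> {}"
  obtains y :: "nat \<Rightarrow> 'a" where "range y \<subseteq> A" "A \<subseteq> closure (range y)"
proof -
  obtain T where T: "countable T" "T \<subseteq> A" "A \<subseteq> closure T" using separable[of A] by blast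
  have "T \<noteq> {}" using T assms by auto
  then have "range (from_nat_into T) = T" using T range_from_nat_into by blast
  then show thesis using that[of "from_nat_into T"] T by simp
qed

text \<open>The inverse temperature \<open>m + 1\<close> outgrows the logarithm of the number of
  points, at most \<open>m + 1\<close>, so the smoothing error \<open>ln (m + 1) / (m + 1)\<close>
  tends to 0.\<close>

lemma soft_max_tendsto_SUP:
  fixes y :: "nat \<Rightarrow> 'a::euclidean_space"
  assumes A: "bounded A" "range y \<subseteq> A" "A \<subseteq> closure (range y)"
  shows "(\<lambda>m. soft_max (real (Suc m)) (y ` {..m}) x) \<longlonglongrightarrow> (SUP z\<in>A. z \<bullet> x)"
proof -
  define h where "h = (SUP z\<in>A. z \<bullet> x)"
  have ne: "A \<noteq> {}" using A by auto
  have le: "z \<bullet> x \<le> h" if "z \<in> A" for z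
    unfolding h_def by (rule cSUP_upper[OF that bdd_above_inner_image[OF A(1)]])
  have up: "soft_max (real (Suc m)) (y ` {..m}) x \<le> h + ln (real (Suc m)) / real (Suc m)" for m
  proof -
    have "soft_max (real (Suc m)) (y ` {..m}) x \<le> h + ln (real (card (y ` {..m}))) / real (Suc m)"
      using A le by (intro soft_max_le) auto
    moreover have "ln (real (card (y ` {..m}))) \<le> ln (real (Suc m))"
    proof (rule ln_mono)
      show "0 < real (card (y ` {..m}))" by (simp add: card_gt_0_iff)
      have "card (y ` {..m}) \<le> Suc m" using card_image_le[of "{..m}" y] by simp
      then show "real (card (y ` {..m})) \<le> real (Suc m)" by simp
    qed
    ultimately show ?thesis by (smt (verit) divide_right_mono of_nat_0_le_iff)
  qed
  have lim: "(\<lambda>m. h + ln (real (Suc m)) / real (Suc m)) \<longlonglongrightarrow> h"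
    by real_asymp
  show ?thesis
    unfolding h_def[symmetric]
  proof (rule order_tendstoI)
    fix a assume "a < h"
    then obtain z where z: "z \<in> A" "a < z \<bullet> x"
      using less_cSUP_iff[OF ne bdd_above_inner_image[OF A(1)]] unfolding h_def by blast
    \<comment> \<open>An open half-space that meets the closure of \<open>range y\<close> contains
      some \<open>y n\<close>.\<close>
    have "open {z. a < z \<bullet> x}" by (intro open_Collect_less continuous_intros)
    then obtain n where n: "a < y n \<bullet> x"
      using z A(3) open_Int_closure_eq_empty[of "{z. a < z \<bullet> x}" "range y"] by blast
    show "eventually (\<lambda>m. a < soft_max (real (Suc m)) (y ` {..m}) x) sequentially"
      using eventually_ge_at_top[of n]
    proof eventually_elim
      case (elim m)
      then have "y n \<bullet> x \<le> soft_max (real (Suc m)) (y ` {..m}) x" by (intro soft_max_ge) auto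
      then show ?case using n by simp
    qed
  next
    fix a assume "h < a"
    then have "eventually (\<lambda>m. h + ln (real (Suc m)) / real (Suc m) < a) sequentially"
      using order_tendstoD(2)[OF lim] by blast
    then show "eventually (\<lambda>m. soft_max (real (Suc m)) (y ` {..m}) x < a) sequentially"
      by eventually_elim (rule le_less_trans[OF up])
  qed
qed

lemma variance_SUP_inner_sphere:
  fixes C :: "'a::euclidean_space set"
  assumes ne: "C \<inter> sphere 0 1 \<noteq> {}"
  defines "h \<equiv> \<lambda>x. SUP y\<in>C \<inter> sphere 0 1. y \<bullet> x"
  shows "(\<integral>x. (h x)\<^sup>2 \<partial>std_gaussian) - (\<integral>x. h x \<partial>std_gaussian)\<^sup>2 \<le> 1"
proof -
  interpret prob_space "std_gaussian :: 'a measure" by (rule prob_space_std_gaussian)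
  let ?A = "C \<inter> sphere 0 1"
  obtain y :: "nat \<Rightarrow> 'a" where y: "range y \<subseteq> ?A" "?A \<subseteq> closure (range y)" by (rule ex_dense_sequence[OF ne])
  \<comment> \<open>One index drives the number of points, the inverse temperature and the
    truncation level together.\<close>
  define L where "L m = soft_max (real (Suc m)) (y ` {..m})" for m
  define f where "f m x = max (- real m) (min (real m) (L m x))" for m x
  \<comment> \<open>A bound uniform in \<open>m\<close>: it supplies the dominating functions and
    shows that at each \<open>x\<close> the truncation is eventually inactive.\<close>
  have Lb: "\<bar>L m x\<bar> \<le> norm x + 1" for m x
  proof -
    have yb: "\<bar>y n \<bullet> x\<bar> \<le> norm x" for n
    proof -
      have "y n \<in> sphere 0 1" using y(1) by blast
      then have "norm (y n) = 1" by simp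
      then show ?thesis using Cauchy_Schwarz_ineq2[of "y n" x] by simp
    qed
    have "y 0 \<bullet> x \<le> L m x" unfolding L_def by (intro soft_max_ge) auto
    moreover have "L m x \<le> norm x + ln (real (card (y ` {..m}))) / real (Suc m)"
      unfolding L_def using yb by (intro soft_max_le) (auto simp: abs_le_iff)
    moreover have "ln (real (card (y ` {..m}))) / real (Suc m) \<le> 1"
    proof -
      have c: "0 < card (y ` {..m})" "card (y ` {..m}) \<le> Suc m"
        using card_image_le[of "{..m}" y] by (auto simp: card_gt_0_iff)
      then have "ln (real (card (y ` {..m}))) \<le> real (card (y ` {..m})) - 1" by (intro ln_le_minus_one) simp
      also have "\<dots> \<le> real (Suc m)" using c by simp
      finally show ?thesis by simp
    qed
    ultimately show ?thesis using yb[of 0] by linarith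
  qed
  have fb: "\<bar>f m x\<bar> \<le> norm x + 1" for m x
    using Lb[of m x] by (auto simp: f_def)
  have flim: "(\<lambda>m. f m x) \<longlonglongrightarrow> h x" for x
  proof (rule Lim_transform_eventually)
    show "(\<lambda>m. L m x) \<longlonglongrightarrow> h x"
      unfolding L_def h_def by (rule soft_max_tendsto_SUP[OF bounded_Int_sphere y])
    obtain n :: nat where n: "norm x + 1 \<le> real n" using real_arch_simple by blast
    show "eventually (\<lambda>m. L m x = f m x) sequentially"
      using eventually_ge_at_top[of n]
    proof eventually_elim
      case (elim m)
      then have "\<bar>L m x\<bar> \<le> real m" using Lb[of m x] n by simp
      then show ?case by (simp add: f_def abs_le_iff)
    qed
  qed
  have [measurable]: "h \<in> borel_measurable borel"
    unfolding h_def by (intro borel_measurable_continuous_onI continuous_SUP_inner_sphere ne)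
  have [measurable]: "f m \<in> borel_measurable borel" for m
    unfolding f_def L_def soft_max_def by measurable
  have int1: "integrable std_gaussian (\<lambda>x::'a. norm x + 1)"
    by (intro Bochner_Integration.integrable_add integrable_std_gaussian_norm) simp
  have int2: "integrable std_gaussian (\<lambda>x::'a. (norm x + 1)\<^sup>2)"
    unfolding power2_sum
    by (intro Bochner_Integration.integrable_add integrable_std_gaussian_norm_squared integrable_mult_left integrable_mult_right integrable_std_gaussian_norm) auto
  have 1: "(\<lambda>m. \<integral>x. f m x \<partial>std_gaussian) \<longlonglongrightarrow> (\<integral>x. h x \<partial>std_gaussian)"
    by (rule integral_dominated_convergence[OF _ _ int1]) (use fb flim in auto)
  have "(f m x)\<^sup>2 \<le> (norm x + 1)\<^sup>2" for m x
    using power_mono[OF fb[of m x], of 2] by simp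
  then have 2: "(\<lambda>m. \<integral>x. (f m x)\<^sup>2 \<partial>std_gaussian) \<longlonglongrightarrow> (\<integral>x. (h x)\<^sup>2 \<partial>std_gaussian)"
    by (intro integral_dominated_convergence[OF _ _ int2]) (auto intro!: tendsto_intros flim)
  have "(\<lambda>m. (\<integral>x. (f m x)\<^sup>2 \<partial>std_gaussian) - (\<integral>x. f m x \<partial>std_gaussian)\<^sup>2)
      \<longlonglongrightarrow> (\<integral>x. (h x)\<^sup>2 \<partial>std_gaussian) - (\<integral>x. h x \<partial>std_gaussian)\<^sup>2"
    by (intro tendsto_intros 1 2)
  then show ?thesis
  proof (rule LIMSEQ_le_const2)
    have "(\<integral>x. (f m x)\<^sup>2 \<partial>std_gaussian) - (\<integral>x. f m x \<partial>std_gaussian)\<^sup>2 \<le> 1" for m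
      unfolding f_def L_def using y(1) by (intro truncated_soft_max_variance) auto
    then show "\<exists>N. \<forall>m\<ge>N. (\<integral>x. (f m x)\<^sup>2 \<partial>std_gaussian) - (\<integral>x. f m x \<partial>std_gaussian)\<^sup>2 \<le> 1" by blast
  qed
qed

text \<open>Normalizing a sequence of \<open>C\<close> that converges to a unit vector keeps it in
  \<open>C\<close> and keeps the limit, so the slice of the closure lies in the closure of the
  slice. Closed half-spaces then carry the same supremum over.\<close>

lemma SUP_inner_closure_cone:
  fixes C :: "'a::euclidean_space set"
  assumes cone: "\<And>c x. c > 0 \<Longrightarrow> x \<in> C \<Longrightarrow> c *\<^sub>R x \<in> C" and ne: "closure C \<inter> sphere 0 1 \<noteq> {}"
  shows "C \<inter> sphere 0 1 \<noteq> {}"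
    and "(SUP y\<in>closure C \<inter> sphere 0 1. y \<bullet> g) = (SUP y\<in>C \<inter> sphere 0 1. y \<bullet> g)"
proof -
  let ?A = "C \<inter> sphere 0 1"
  have approx: "z \<in> closure ?A" if z: "z \<in> closure C \<inter> sphere 0 1" for z
  proof -
    obtain x where x: "\<And>n. x n \<in> C" "x \<longlonglongrightarrow> z" using z closure_sequential[of z C] by blast
    have z0: "norm z = 1" using z by simp
    then have "eventually (\<lambda>n. x n \<noteq> 0) sequentially"
      using x(2) tendsto_imp_eventually_ne[of x z sequentially 0] by fastforce
    then have "eventually (\<lambda>n. inverse (norm (x n)) *\<^sub>R x n \<in> closure ?A) sequentially"
    proof eventually_elim
      case (elim n)
      then have "inverse (norm (x n)) *\<^sub>R x n \<in> ?A" using cone x(1) by simp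
      then show ?case by (rule subsetD[OF closure_subset])
    qed
    moreover have "(\<lambda>n. inverse (norm (x n)) *\<^sub>R x n) \<longlonglongrightarrow> inverse (norm z) *\<^sub>R z"
      by (intro tendsto_intros x(2)) (use z0 in auto)
    ultimately have "inverse (norm z) *\<^sub>R z \<in> closure ?A"
      by (intro Lim_in_closed_set[OF closed_closure]) auto
    then show ?thesis using z0 by simp
  qed
  show neA: "?A \<noteq> {}" using approx ne by force
  show "(SUP y\<in>closure C \<inter> sphere 0 1. y \<bullet> g) = (SUP y\<in>?A. y \<bullet> g)"
  proof (rule antisym)
    show "(SUP y\<in>closure C \<inter> sphere 0 1. y \<bullet> g) \<le> (SUP y\<in>?A. y \<bullet> g)"
    proof (rule cSUP_least[OF ne])
      fix z assume "z \<in> closure C \<inter> sphere 0 1"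
      then have "z \<in> closure ?A" by (rule approx)
      moreover have "closure ?A \<subseteq> {z. z \<bullet> g \<le> (SUP y\<in>?A. y \<bullet> g)}"
      proof (rule closure_minimal)
        show "?A \<subseteq> {z. z \<bullet> g \<le> (SUP y\<in>?A. y \<bullet> g)}"
          using cSUP_upper[OF _ bdd_above_inner_image[OF bounded_Int_sphere]] by blast
        show "closed {z. z \<bullet> g \<le> (SUP y\<in>?A. y \<bullet> g)}"
          by (intro closed_Collect_le continuous_intros)
      qed
      ultimately show "z \<bullet> g \<le> (SUP y\<in>?A. y \<bullet> g)" by blast
    qed
    show "(SUP y\<in>?A. y \<bullet> g) \<le> (SUP y\<in>closure C \<inter> sphere 0 1. y \<bullet> g)"
      using closure_subset[of C] by (intro cSUP_subset_mono neA bdd_above_inner_image bounded_Int_sphere) auto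
  qed
qed

lemma statistical_dimension_eq:
  fixes C :: "(real ^ 'n) set"
  assumes C: "convex C" "\<And>c x. c > 0 \<Longrightarrow> x \<in> C \<Longrightarrow> c *\<^sub>R x \<in> C"
  shows "statistical_dimension C = (\<integral>g. (cone_projection_norm (closure C) g)\<^sup>2 \<partial>std_gaussian)"
proof -
  have "\<exists>P. (\<forall>i::nat. polyhedral_cone (P i)) \<and> (\<lambda>i. conic_hausdorff_dist (P i) (closure C)) \<longlonglongrightarrow> 0"
  proof (cases "C = {}")
    \<comment> \<open>The empty set satisfies the hypotheses; its slice is that of
      \<open>{0}\<close>, and \<open>conic_hausdorff_dist\<close> sees only slices.\<close>
    case True
    then have "conic_hausdorff_dist P (closure C) = conic_hausdorff_dist P {0}" for P
      by (simp add: conic_hausdorff_dist_def hausdorff_dist_def)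
    then show ?thesis
      using ex_polyhedral_cone_approx[of "{0::real^'n}"] by simp
  next
    case False
    have "conic (closure C)"
      unfolding conic_def
    proof (intro allI impI)
      fix x and c :: real assume x: "x \<in> closure C" and c: "0 \<le> c"
      obtain s where s: "\<And>n. s n \<in> C" "s \<longlonglongrightarrow> x" using x closure_sequential[of x C] by blast
      \<comment> \<open>The hypothesis scales by positive factors only; positive factors tending to
        \<open>c\<close> also reach \<open>c = 0\<close>.\<close>
      define d where "d n = c + 1 / real (Suc n)" for n
      have "d n > 0" for n using c by (simp add: d_def add_nonneg_pos)
      then have "d n *\<^sub>R s n \<in> C" for n using C(2) s(1) by blast
      moreover have "(\<lambda>n. 1 / real (Suc n)) \<longlonglongrightarrow> 0" by real_asymp
      then have "d \<longlonglongrightarrow> c + 0" unfolding d_def by (intro tendsto_intros)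
      then have "(\<lambda>n. d n *\<^sub>R s n) \<longlonglongrightarrow> c *\<^sub>R x" using s(2) by (intro tendsto_intros) auto
      ultimately show "c *\<^sub>R x \<in> closure C"
        unfolding closure_sequential by (intro exI[of _ "\<lambda>n. d n *\<^sub>R s n"]) simp
    qed
    then have "convex_cone (closure C)"
      using False C(1) by (simp add: convex_cone_def convex_closure)
    then show ?thesis by (intro ex_polyhedral_cone_approx) auto
  qed
  then show ?thesis
    using sum_intrinsic_volume_eq[of _ "closure C"] by (auto simp: statistical_dimension_def)
qed

theorem proposition10p2:
  fixes C :: "(real ^ 'n) set"
  assumes "convex C"
    and "\<And>\<tau>::real. \<tau> > 0 \<Longrightarrow> (\<lambda>x. \<tau> *\<^sub>R x) ` C = C"
  shows "(gaussian_width C)\<^sup>2 \<le> statistical_dimension C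
       \<and> statistical_dimension C \<le> (gaussian_width C)\<^sup>2 + 1"
proof -
  interpret prob_space "std_gaussian :: (real^'n) measure" by (rule prob_space_std_gaussian)
  have cone: "c *\<^sub>R x \<in> C" if "c > 0" "x \<in> C" for c x
    using assms(2)[OF that(1)] that(2) by blast
  have sd: "statistical_dimension C = (\<integral>g. (cone_projection_norm (closure C) g)\<^sup>2 \<partial>std_gaussian)"
    by (rule statistical_dimension_eq[OF assms(1) cone])
  show ?thesis
  proof (cases "closure C \<inter> sphere 0 1 = {}")
    \<comment> \<open>The empty and the trivial cone: width and statistical dimension are both
      0.\<close>
    case True
    then have "C \<inter> sphere 0 1 = {}" using closure_subset[of C] by blast
    then show ?thesis using True by (simp add: sd gaussian_width_def cone_projection_norm_def)
  next
    case False
    note ne = SUP_inner_closure_cone(1)[OF cone False]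
    define h where "h g = (SUP y\<in>C \<inter> sphere 0 1. y \<bullet> g)" for g
    have w: "gaussian_width C = (\<integral>g. h g \<partial>std_gaussian)"
      using ne by (simp add: gaussian_width_def h_def)
    have N: "cone_projection_norm (closure C) g = max 0 (h g)" for g
      using False SUP_inner_closure_cone(2)[OF cone False, of g] by (simp add: cone_projection_norm_def h_def)
    have hb: "\<bar>h g\<bar> \<le> norm g" for g unfolding h_def by (rule SUP_inner_sphere_le_norm[OF ne])
    have [measurable]: "h \<in> borel_measurable borel"
      unfolding h_def by (intro borel_measurable_continuous_onI continuous_SUP_inner_sphere ne)
    have ih: "integrable std_gaussian h"
      by (rule Bochner_Integration.integrable_bound[OF integrable_std_gaussian_norm]) (use hb in auto)
    have ip: "integrable std_gaussian (\<lambda>g. max 0 (h g))"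
      by (intro integrable_max ih) simp
    have hb2: "(h g)\<^sup>2 \<le> (norm g)\<^sup>2" for g using power_mono[OF hb[of g], of 2] by simp
    have ih2: "integrable std_gaussian (\<lambda>g. (h g)\<^sup>2)"
      by (rule Bochner_Integration.integrable_bound[OF integrable_std_gaussian_norm_squared]) (use hb2 in auto)
    have pb2: "(max 0 (h g))\<^sup>2 \<le> (h g)\<^sup>2" for g by (simp add: max_def)
    have ip2: "integrable std_gaussian (\<lambda>g. (max 0 (h g))\<^sup>2)"
      by (rule Bochner_Integration.integrable_bound[OF ih2]) (use pb2 in auto)
    \<comment> \<open>One unit vector of \<open>C\<close> suffices for a nonnegative width: h
      dominates its inner product with \<open>g\<close>, whose mean is 0. The sign is what permits
      squaring the comparison of the width with the mean projection norm.\<close>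
    obtain y where y: "y \<in> C \<inter> sphere 0 1" using ne by blast
    have "0 = (\<integral>g. y \<bullet> g \<partial>std_gaussian)" by (simp add: integral_std_gaussian_inner)
    also have "\<dots> \<le> (\<integral>g. h g \<partial>std_gaussian)"
    proof (intro integral_mono ih integral_std_gaussian_inner)
      show "y \<bullet> g \<le> h g" for g
        unfolding h_def by (rule cSUP_upper[OF y bdd_above_inner_image[OF bounded_Int_sphere]])
    qed
    finally have w0: "0 \<le> gaussian_width C" by (simp add: w)
    have "gaussian_width C \<le> (\<integral>g. max 0 (h g) \<partial>std_gaussian)"
      unfolding w by (intro integral_mono ih ip) auto
    then have "(gaussian_width C)\<^sup>2 \<le> (\<integral>g. max 0 (h g) \<partial>std_gaussian)\<^sup>2"
      using w0 by (rule power_mono)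
    also have "\<dots> \<le> statistical_dimension C"
      unfolding sd N by (intro expectation_squared_le ip ip2)
    finally have lower: "(gaussian_width C)\<^sup>2 \<le> statistical_dimension C" .
    have "statistical_dimension C \<le> (\<integral>g. (h g)\<^sup>2 \<partial>std_gaussian)"
      unfolding sd N by (intro integral_mono ip2 ih2 pb2)
    also have "\<dots> \<le> (gaussian_width C)\<^sup>2 + 1"
      using variance_SUP_inner_sphere[OF ne] by (simp add: w h_def)
    finally show ?thesis using lower by blast
  qed
qed

end
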